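(* Let $p$ be a prime, $R\ge1$, $V=\mathbb{F}_{p^R}$, $V^*=V\setminus\{0\}$. Let $G_0=\langle\widehat{\omega}^d,\widehat{\omega}^e\alpha^s\rangle$ and $M_0=\langle\widehat{\omega}^{d_1},\widehat{\omega}^{e_1}\alpha^{s_1}\rangle$ be subgroups of $\Gamma L(1,p^R)$ in standard form with $M_0\trianglelefteq G_0$, $G_0$ transitive on $V^*$ and $M_0$ not transitive on $V^*$, and suppose $|M_0|$ is even if $p$ is odd. Let $G=T\rtimes G_0$, $M=T\rtimes M_0$, let $S_1,\dots,S_k$ be the $M_0$-orbits on $V^*$, $\Gamma_i=\mathrm{Cay}(V,S_i)$, and $\mathcal{E}=\{E\Gamma_1,\dots,E\Gamma_k\}$ with $E\Gamma_i=\{\{u,v\}:v-u\in S_i\}$. Then $(M,G,V,\mathcal{E})$ is a homogeneous factorisation of $K_{p^R}=(V,E)$ of index $k=d_1/c$, where $c=1$ if $e_1=0$ and otherwise $c$ is the least positive integer with $d_1\mid e_1\frac{p^{cs_1}-1}{p^{s_1}-1}$, and each factor $\Gamma_i$ is undirected and $M$-arc-transitive. Conversely, every homogeneous factorisation $(M,G,V,\mathcal{E})$ of $K_{p^R}=(V,E)$ of index $k$ in which $M$ is arc-transitive on each factor, $G$ is a $2$-transitive subgroup of $A\Gamma L(1,p^R)$ and $|M|$ is even, arises from this construction.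
   Context: $\omega$ is a primitive element of $\mathbb{F}_{p^R}$, $\widehat{\omega}: x\mapsto x\omega$, $\alpha: x\mapsto x^p$, maps acting on the right; $T$ is the translation group of $V$ and $A\Gamma L(1,p^R)=T\rtimes\langle\widehat{\omega},\alpha\rangle$. A subgroup $\langle\widehat{\omega}^d,\widehat{\omega}^e\alpha^s\rangle$ is in standard form if $d>0$, $d\mid p^R-1$; $s>0$, $s\mid R$; $0\le e<d$ and $e(p^R-1)/(p^s-1)\equiv0\pmod d$. $\mathrm{Cay}(V,S)$ has edges $\{u,v\}$ with $v-u\in S$. A homogeneous factorisation of index $k>1$ of $K_n=(V,E)$ is a 4-tuple $(M,G,V,\mathcal{E})$ where $\mathcal{E}$ partitions the 2-subsets of $V$ into $k$ parts, $G\le\mathrm{Sym}(V)$ is transitive on $V$, leaves $\mathcal{E}$ invariant and permutes its parts transitively, and the kernel $M$ of this action is transitive on $V$.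
   Formalization: M need not be the whole kernel (false in F_9 with G_0=ΓL(1,9), M_0=⟨ω̂²⟩): M is only required to be a transitive normal subgroup of G inside the kernel, in both directions; the actual kernel is also shown to give a homogeneous factorisation in the original sense. *)

theory Defs
  imports
    Complex_Main
    "HOL-Algebra.Bij"
    "HOL-Algebra.Generated_Groups"
    "HOL-Library.Disjoint_Sets"
    "HOL-Library.Cardinality"
    "HOL-Number_Theory.Cong"
begin

text \<open>
  The field \<open>V = F\<^bsub>p^R\<^esub>\<close> is the universe of a finite field type \<open>'a\<close> with \<open>CARD('a) = p ^ R\<close>.
  Permutations of \<open>V\<close> are functions \<open>'a \<Rightarrow> 'a\<close>, and \<open>Sym(V)\<close> is \<open>BijGroup UNIV\<close>, whose product is
  function composition.  Since maps act on the right in the source, a product written \<open>a b\<close> there is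
  the composition \<open>b \<circ> a\<close> here.
\<close>

abbreviation Sym :: "('a \<Rightarrow> 'a) monoid" where
  "Sym \<equiv> BijGroup UNIV"

abbreviation nonzero :: "'a::zero set" where
  "nonzero \<equiv> UNIV - {0}"

definition primitive_element :: "'a::field \<Rightarrow> bool" where
  "primitive_element \<omega> \<longleftrightarrow> range (\<lambda>n::nat. \<omega> ^ n) = nonzero"

definition mult_map :: "'a::field \<Rightarrow> 'a \<Rightarrow> 'a" where
  "mult_map \<omega> = (\<lambda>x. x * \<omega>)"

definition frob :: "nat \<Rightarrow> 'a::field \<Rightarrow> 'a" where
  "frob p = (\<lambda>x. x ^ p)"

definition translation_group :: "('a::field \<Rightarrow> 'a) set" where
  "translation_group = range (\<lambda>t x. x + t)"

definition GammaL1 :: "nat \<Rightarrow> 'a::field \<Rightarrow> ('a \<Rightarrow> 'a) set" where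
  "GammaL1 p \<omega> = generate Sym {mult_map \<omega>, frob p}"

text \<open>
  For \<open>H \<le> \<Gamma>L(1,p^R)\<close> the semidirect product \<open>T \<rtimes> H\<close> is internal to \<open>Sym(V)\<close>, i.e. it is the
  product set \<open>T H\<close>.
\<close>

definition affine_group :: "('a::field \<Rightarrow> 'a) set \<Rightarrow> ('a \<Rightarrow> 'a) set" where
  "affine_group H = translation_group <#>\<^bsub>Sym\<^esub> H"

definition AGammaL1 :: "nat \<Rightarrow> 'a::field \<Rightarrow> ('a \<Rightarrow> 'a) set" where
  "AGammaL1 p \<omega> = affine_group (GammaL1 p \<omega>)"

definition standard_form :: "nat \<Rightarrow> nat \<Rightarrow> nat \<Rightarrow> nat \<Rightarrow> nat \<Rightarrow> bool" where
  "standard_form p R d e s \<longleftrightarrow>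
     d > 0 \<and> d dvd p ^ R - 1 \<and> s > 0 \<and> s dvd R \<and> e < d \<and>
     [e * ((p ^ R - 1) div (p ^ s - 1)) = 0] (mod d)"

definition GammaL1_subgroup :: "nat \<Rightarrow> 'a::field \<Rightarrow> nat \<Rightarrow> nat \<Rightarrow> nat \<Rightarrow> ('a \<Rightarrow> 'a) set" where
  "GammaL1_subgroup p \<omega> d e s =
     generate Sym {mult_map \<omega> ^^ d, (frob p ^^ s) \<circ> (mult_map \<omega> ^^ e)}"

definition transitive_on :: "('a \<Rightarrow> 'a) set \<Rightarrow> 'a set \<Rightarrow> bool" where
  "transitive_on H X \<longleftrightarrow> (\<forall>x\<in>X. \<forall>y\<in>X. \<exists>h\<in>H. h x = y)"

definition two_transitive :: "('a \<Rightarrow> 'a) set \<Rightarrow> bool" where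
  "two_transitive H \<longleftrightarrow>
     (\<forall>u v x y. u \<noteq> v \<longrightarrow> x \<noteq> y \<longrightarrow> (\<exists>h\<in>H. h u = x \<and> h v = y))"

definition orbits_on :: "('a \<Rightarrow> 'a) set \<Rightarrow> 'a set \<Rightarrow> 'a set set" where
  "orbits_on H X = (\<lambda>x. (\<lambda>h. h x) ` H) ` X"

definition complete_edges :: "'a set set" where
  "complete_edges = {e. card e = 2}"

definition cayley_arcs :: "'a::field set \<Rightarrow> ('a \<times> 'a) set" where
  "cayley_arcs S = {(u, v). v - u \<in> S}"

definition cayley_edges :: "'a::field set \<Rightarrow> 'a set set" where
  "cayley_edges S = {{u, v} | u v. v - u \<in> S}"

definition edge_image :: "('a \<Rightarrow> 'a) \<Rightarrow> 'a set set \<Rightarrow> 'a set set" where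
  "edge_image g E = (\<lambda>e. g ` e) ` E"

definition arc_transitive :: "('a \<Rightarrow> 'a) set \<Rightarrow> 'a set set \<Rightarrow> bool" where
  "arc_transitive M E \<longleftrightarrow>
     (\<forall>g\<in>M. edge_image g E = E) \<and>
     (\<forall>u v x y. u \<noteq> v \<longrightarrow> {u, v} \<in> E \<longrightarrow> x \<noteq> y \<longrightarrow> {x, y} \<in> E \<longrightarrow> (\<exists>g\<in>M. g u = x \<and> g v = y))"

definition factor_kernel :: "('a \<Rightarrow> 'a) set \<Rightarrow> 'a set set set \<Rightarrow> ('a \<Rightarrow> 'a) set" where
  "factor_kernel G \<E> = {g \<in> G. \<forall>E\<in>\<E>. edge_image g E = E}"

definition transitive_factorisation :: "('a \<Rightarrow> 'a) set \<Rightarrow> 'a set set set \<Rightarrow> nat \<Rightarrow> bool" where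
  "transitive_factorisation G \<E> k \<longleftrightarrow>
     k > 1 \<and> partition_on complete_edges \<E> \<and> finite \<E> \<and> card \<E> = k \<and>
     subgroup G Sym \<and> transitive_on G UNIV \<and>
     (\<forall>g\<in>G. edge_image g ` \<E> = \<E>) \<and>
     (\<forall>E\<in>\<E>. \<forall>F\<in>\<E>. \<exists>g\<in>G. edge_image g E = F)"

definition homogeneous_factorisation ::
  "('a \<Rightarrow> 'a) set \<Rightarrow> ('a \<Rightarrow> 'a) set \<Rightarrow> 'a set set set \<Rightarrow> nat \<Rightarrow> bool" where
  "homogeneous_factorisation M G \<E> k \<longleftrightarrow>
     transitive_factorisation G \<E> k \<and> M = factor_kernel G \<E> \<and> transitive_on M UNIV"

text \<open>
  The group \<open>T \<rtimes> M\<^sub>0\<close> of the construction below fixes every factor, but it need not be the whole kernel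
  of \<open>G\<close> on the factors: in \<open>F\<^sub>9\<close> take \<open>G\<^sub>0 = \<Gamma>L(1,9)\<close> and let \<open>M\<^sub>0\<close> consist of the multiplications by
  nonzero squares; then \<open>x \<mapsto> x^3\<close> fixes both factors without belonging to \<open>T \<rtimes> M\<^sub>0\<close>.  The following
  variant therefore admits any transitive normal subgroup of \<open>G\<close> contained in the kernel.
\<close>

definition weak_homogeneous_factorisation ::
  "('a \<Rightarrow> 'a) set \<Rightarrow> ('a \<Rightarrow> 'a) set \<Rightarrow> 'a set set set \<Rightarrow> nat \<Rightarrow> bool" where
  "weak_homogeneous_factorisation M G \<E> k \<longleftrightarrow>
     transitive_factorisation G \<E> k \<and> M \<lhd> Sym\<lparr>carrier := G\<rparr> \<and>
     M \<subseteq> factor_kernel G \<E> \<and> transitive_on M UNIV"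

lemma edge_image_comp: "edge_image (g \<circ> h) E = edge_image g (edge_image h E)"
  by (auto simp: edge_image_def image_image image_comp)

lemma Sym_mult: "g \<in> carrier Sym \<Longrightarrow> h \<in> carrier Sym \<Longrightarrow> g \<otimes>\<^bsub>Sym\<^esub> h = g \<circ> h"
  by (auto simp: BijGroup_def compose_def)

lemma Sym_one: "\<one>\<^bsub>Sym\<^esub> = id"
  by (auto simp: BijGroup_def)

lemma factor_kernel_normal:
  assumes G: "subgroup G Sym" and perm: "\<forall>g\<in>G. edge_image g ` \<E> = \<E>"
  shows "factor_kernel G \<E> \<lhd> Sym\<lparr>carrier := G\<rparr>"
proof -
  interpret S: group Sym by (rule group_BijGroup)
  let ?H = "Sym\<lparr>carrier := G\<rparr>"
  interpret H: group ?H by (rule S.subgroup_imp_group[OF G])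
  have mem: "g \<in> carrier Sym" if "g \<in> G" for g
    using subgroup.subset[OF G] that by blast
  have mult: "g \<otimes>\<^bsub>?H\<^esub> h = g \<circ> h" if "g \<in> G" "h \<in> G" for g h
    using Sym_mult[OF mem[OF that(1)] mem[OF that(2)]] by simp
  have one: "edge_image (\<one>\<^bsub>?H\<^esub>) E = E" for E :: "'a set set"
    by (simp add: Sym_one edge_image_def)
  have icl: "inv\<^bsub>?H\<^esub> g \<in> G" if "g \<in> G" for g
    using H.inv_closed[of g] that by simp
  have r_inv: "edge_image g (edge_image (inv\<^bsub>?H\<^esub> g) E) = E" if "g \<in> G" for g E
    using H.r_inv[of g] that one[of E] mult[OF that icl[OF that]]
    by (simp add: edge_image_comp[symmetric])
  have l_inv: "edge_image (inv\<^bsub>?H\<^esub> g) (edge_image g E) = E" if "g \<in> G" for g E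
    using H.l_inv[of g] that one[of E] mult[OF icl[OF that] that]
    by (simp add: edge_image_comp[symmetric])
  have mcl: "g \<otimes>\<^bsub>?H\<^esub> h \<in> G" if "g \<in> G" "h \<in> G" for g h
    using H.m_closed[of g h] that by simp
  have "subgroup (factor_kernel G \<E>) ?H"
  proof (rule H.subgroupI)
    show "factor_kernel G \<E> \<subseteq> carrier ?H"
      by (auto simp: factor_kernel_def)
    have "\<one>\<^bsub>?H\<^esub> \<in> factor_kernel G \<E>"
      using one H.one_closed by (auto simp: factor_kernel_def)
    then show "factor_kernel G \<E> \<noteq> {}" by blast
    show "inv\<^bsub>?H\<^esub> a \<in> factor_kernel G \<E>" if a: "a \<in> factor_kernel G \<E>" for a
    proof -
      have "edge_image (inv\<^bsub>?H\<^esub> a) E = E" if "E \<in> \<E>" for E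
        using l_inv[of a E] a that by (simp add: factor_kernel_def)
      then show ?thesis using a icl by (simp add: factor_kernel_def)
    qed
    show "a \<otimes>\<^bsub>?H\<^esub> b \<in> factor_kernel G \<E>"
      if "a \<in> factor_kernel G \<E>" "b \<in> factor_kernel G \<E>" for a b
      using that mcl[of a b] mult[of a b] by (simp add: factor_kernel_def edge_image_comp)
  qed
  moreover have "x \<otimes>\<^bsub>?H\<^esub> h \<otimes>\<^bsub>?H\<^esub> inv\<^bsub>?H\<^esub> x \<in> factor_kernel G \<E>"
    if x: "x \<in> carrier ?H" and h: "h \<in> factor_kernel G \<E>" for x h
  proof -
    have xG: "x \<in> G" and hG: "h \<in> G" using x h by (auto simp: factor_kernel_def)
    have "edge_image (x \<otimes>\<^bsub>?H\<^esub> h \<otimes>\<^bsub>?H\<^esub> inv\<^bsub>?H\<^esub> x) E = E" if "E \<in> \<E>" for E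
    proof -
      have "edge_image (inv\<^bsub>?H\<^esub> x) E \<in> \<E>"
        using perm icl[OF xG] that by blast
      then have "edge_image h (edge_image (inv\<^bsub>?H\<^esub> x) E) = edge_image (inv\<^bsub>?H\<^esub> x) E"
        using h by (simp add: factor_kernel_def)
      then show ?thesis
        using r_inv[OF xG] mult[OF mcl[OF xG hG] icl[OF xG]] mult[OF xG hG]
        by (simp add: edge_image_comp)
    qed
    then show ?thesis
      using mcl[OF mcl[OF xG hG] icl[OF xG]] by (simp add: factor_kernel_def)
  qed
  ultimately show ?thesis
    using H.normal_inv_iff by blast
qed

lemma homogeneous_imp_weak:
  "homogeneous_factorisation M G \<E> k \<Longrightarrow> weak_homogeneous_factorisation M G \<E> k"
  by (auto simp: homogeneous_factorisation_def weak_homogeneous_factorisation_def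
      transitive_factorisation_def intro!: factor_kernel_normal)

definition admissible ::
  "nat \<Rightarrow> nat \<Rightarrow> 'a::field \<Rightarrow> nat \<Rightarrow> nat \<Rightarrow> nat \<Rightarrow> nat \<Rightarrow> nat \<Rightarrow> nat \<Rightarrow> bool" where
  "admissible p R \<omega> d e s d1 e1 s1 \<longleftrightarrow>
     (let G0 = GammaL1_subgroup p \<omega> d e s; M0 = GammaL1_subgroup p \<omega> d1 e1 s1 in
        standard_form p R d e s \<and> standard_form p R d1 e1 s1 \<and>
        M0 \<lhd> Sym\<lparr>carrier := G0\<rparr> \<and>
        transitive_on G0 nonzero \<and> \<not> transitive_on M0 nonzero \<and>
        (odd p \<longrightarrow> even (card M0)))"

definition orbit_factors :: "('a::field \<Rightarrow> 'a) set \<Rightarrow> 'a set set set" where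
  "orbit_factors M0 = cayley_edges ` orbits_on M0 nonzero"

definition merge_length :: "nat \<Rightarrow> nat \<Rightarrow> nat \<Rightarrow> nat \<Rightarrow> nat" where
  "merge_length p d1 e1 s1 =
     (if e1 = 0 then 1
      else LEAST c. c > 0 \<and> d1 dvd e1 * ((p ^ (c * s1) - 1) div (p ^ s1 - 1)))"

end

theory Submission
  imports Defs "HOL-Algebra.Sylow" "HOL-Number_Theory.Residues"
begin

text \<open>
  For the construction, all \<open>M\<^sub>0\<close>-orbits on \<open>V\<^sup>*\<close> have the same size because \<open>G\<^sub>0\<close> is transitive and
  normalises \<open>M\<^sub>0\<close>, so the index is read off the orbit of \<open>1\<close>: on exponents of \<open>\<omega>\<close> modulo \<open>d\<^sub>1\<close> the group
  \<open>M\<^sub>0\<close> acts through its second generator, and \<open>c\<close> is the length of the cycle through \<open>0\<close>.  The factors are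
  undirected because \<open>M\<close> has even order: an involution of \<open>M\<close> swaps some pair of points, and its
  conjugates under the 2-transitive group \<open>G\<close> swap every pair.

  Conversely, let \<open>G\<close> be a 2-transitive subgroup of \<open>A\<Gamma>L(1,q)\<close>, where \<open>q = p^R\<close>.  If \<open>G\<close> contained no
  nontrivial translation, it would embed into \<open>\<Gamma>L(1,q)\<close>, whence \<open>q (q - 1) \<le> (q - 1) R\<close>, contradicting
  \<open>R < p^R\<close>.  The commutator of an element of \<open>M\<close> with a translation is a translation in \<open>M\<close>, and
  an element commuting with all translations is itself one, so \<open>M\<close> contains a nontrivial translation too; conjugation under \<open>G\<close> produces all of \<open>T\<close> inside \<open>M\<close>.  Thus
  \<open>G\<close> and \<open>M\<close> are the semidirect products of \<open>T\<close> with their stabilisers of \<open>0\<close>, and these are brought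
  into standard form by choosing the least positive \<open>d\<close> and \<open>s\<close>.
\<close>

section \<open>Permutation groups\<close>

lemma carrier_Sym_iff: "g \<in> carrier Sym \<longleftrightarrow> bij g"
  by (simp add: BijGroup_def Bij_def)

lemma subgroup_SymD:
  assumes "subgroup H Sym"
  shows "g \<in> H \<Longrightarrow> bij g" "id \<in> H" "g \<in> H \<Longrightarrow> h \<in> H \<Longrightarrow> g \<circ> h \<in> H"
    "g \<in> H \<Longrightarrow> inv_into UNIV g \<in> H"
proof -
  show bij: "bij g" if "g \<in> H" for g
    using subgroup.subset[OF assms] that carrier_Sym_iff by blast
  show "id \<in> H"
    using subgroup.one_closed[OF assms] by (simp add: Sym_one)
  show "g \<circ> h \<in> H" if "g \<in> H" "h \<in> H"
    using subgroup.m_closed[OF assms that] that bij Sym_mult[of g h] by (simp add: carrier_Sym_iff)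
  show "inv_into UNIV g \<in> H" if "g \<in> H"
    using subgroup.m_inv_closed[OF assms that] inv_BijGroup[of g UNIV] bij[OF that]
    by (simp add: Bij_def restrict_def)
qed

text \<open>On a finite set closure under inverses is automatic: composing with \<open>a\<close> is
  an injective map of \<open>H\<close> into itself, hence onto, so it reaches
  \<open>id\<close>.\<close>

lemma subgroup_SymI:
  assumes "\<And>g. g \<in> H \<Longrightarrow> bij g" "id \<in> H" "\<And>g h. g \<in> H \<Longrightarrow> h \<in> H \<Longrightarrow> g \<circ> h \<in> H"
  shows "subgroup (H :: ('a::finite \<Rightarrow> 'a) set) Sym"
proof -
  interpret S: group Sym by (rule group_BijGroup)
  show ?thesis
  proof (rule S.subgroupI)
    show "H \<subseteq> carrier Sym" using assms(1) by (auto simp: carrier_Sym_iff)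
    show "H \<noteq> {}" using assms(2) by blast
    show "a \<otimes>\<^bsub>Sym\<^esub> b \<in> H" if "a \<in> H" "b \<in> H" for a b
      using that assms by (simp add: Sym_mult carrier_Sym_iff)
    show "inv\<^bsub>Sym\<^esub> a \<in> H" if a: "a \<in> H" for a
    proof -
      have "inj_on ((\<circ>) a) H"
        using bij_is_inj[OF assms(1)[OF a]] by (auto simp: inj_on_def fun_eq_iff)
      then have "(\<circ>) a ` H = H"
        using assms(3)[OF a] by (intro card_subset_eq) (auto simp: card_image)
      then obtain b where b: "b \<in> H" "a \<circ> b = id" using assms(2) by (metis imageE)
      then have "b = inv\<^bsub>Sym\<^esub> a"
        using S.inv_equality[of a b] S.inv_inv[of b] S.inv_inv[of a] assms(1) a
        by (simp add: carrier_Sym_iff Sym_mult Sym_one)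
      with b show ?thesis by simp
    qed
  qed
qed

text \<open>The form \<open>g \<circ> h = h' \<circ> g\<close> lets later proofs evaluate functions
  at points instead of handling group inverses.\<close>

lemma normal_Sym_iff:
  assumes G: "subgroup G Sym"
  shows "M \<lhd> Sym\<lparr>carrier := G\<rparr> \<longleftrightarrow>
    subgroup M Sym \<and> M \<subseteq> G \<and> (\<forall>g\<in>G. \<forall>h\<in>M. \<exists>h'\<in>M. g \<circ> h = h' \<circ> g)"
proof -
  interpret S: group Sym by (rule group_BijGroup)
  let ?H = "Sym\<lparr>carrier := G\<rparr>"
  interpret H: group ?H by (rule S.subgroup_imp_group[OF G])
  have sub: "subgroup M ?H \<longleftrightarrow> subgroup M Sym \<and> M \<subseteq> G"
  proof
    show "subgroup M Sym \<and> M \<subseteq> G" if "subgroup M ?H"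
      using S.incl_subgroup[OF G that] subgroup.subset[OF that] by simp
    show "subgroup M ?H" if "subgroup M Sym \<and> M \<subseteq> G"
      using S.subgroup_incl[OF _ G] that by blast
  qed
  have conj: "g \<otimes>\<^bsub>?H\<^esub> h \<otimes>\<^bsub>?H\<^esub> inv\<^bsub>?H\<^esub> g \<in> M \<longleftrightarrow> (\<exists>h'\<in>M. g \<circ> h = h' \<circ> g)"
    if "M \<subseteq> G" and g: "g \<in> G" and "h \<in> M" for g h
  proof -
    let ?g' = "inv_into UNIV g"
    have bij: "bij g" "bij h" "bij ?g'"
      using that subgroup_SymD(1)[OF G] bij_imp_bij_inv by blast+
    have inv: "g \<circ> ?g' = id" "?g' \<circ> g = id"
      using bij(1) surj_iff[of g] by (simp_all add: bij_is_inj bij_is_surj)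
    have "inv\<^bsub>?H\<^esub> g = ?g'"
      using S.m_inv_consistent[OF G g] inv_BijGroup[of g UNIV] bij(1) by (simp add: Bij_def restrict_def)
    then have "g \<otimes>\<^bsub>?H\<^esub> h \<otimes>\<^bsub>?H\<^esub> inv\<^bsub>?H\<^esub> g = g \<circ> h \<circ> ?g'"
      using bij by (simp add: Sym_mult carrier_Sym_iff bij_comp)
    moreover have "g \<circ> h \<circ> ?g' = h'" if "g \<circ> h = h' \<circ> g" for h'
      unfolding that comp_assoc inv by simp
    moreover have "g \<circ> h = (g \<circ> h \<circ> ?g') \<circ> g"
      unfolding comp_assoc inv by simp
    ultimately show ?thesis by metis
  qed
  have "M \<lhd> ?H \<longleftrightarrow> subgroup M ?H \<and>
      (\<forall>g\<in>carrier ?H. \<forall>h\<in>M. g \<otimes>\<^bsub>?H\<^esub> h \<otimes>\<^bsub>?H\<^esub> inv\<^bsub>?H\<^esub> g \<in> M)"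
    by (rule H.normal_inv_iff)
  moreover have "carrier ?H = G" by simp
  ultimately have iff: "M \<lhd> ?H \<longleftrightarrow> (subgroup M Sym \<and> M \<subseteq> G) \<and>
      (\<forall>g\<in>G. \<forall>h\<in>M. g \<otimes>\<^bsub>?H\<^esub> h \<otimes>\<^bsub>?H\<^esub> inv\<^bsub>?H\<^esub> g \<in> M)"
    by (simp only: sub)
  show ?thesis
  \<comment> \<open>\<open>conj\<close> is available only when \<open>M \<subseteq> G\<close>;
    otherwise both sides are false.\<close>
  proof (cases "M \<subseteq> G")
    case True
    have "(\<forall>g\<in>G. \<forall>h\<in>M. g \<otimes>\<^bsub>?H\<^esub> h \<otimes>\<^bsub>?H\<^esub> inv\<^bsub>?H\<^esub> g \<in> M) \<longleftrightarrow>
        (\<forall>g\<in>G. \<forall>h\<in>M. \<exists>h'\<in>M. g \<circ> h = h' \<circ> g)"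
      by (intro ball_cong refl conj[OF True])
    then show ?thesis by (simp only: iff True conj_assoc simp_thms)
  qed (simp only: iff simp_thms)
qed

text \<open>Sylow's theorem for the prime 2 with exponent 1 supplies an involution \<open>t\<close>
  in \<open>M\<close>. It moves some \<open>u\<close>; conjugating by an element of \<open>G\<close>
  that carries \<open>u\<close>, \<open>t u\<close> to \<open>x\<close>, \<open>y\<close> turns it
  into a swap of \<open>x\<close> and \<open>y\<close>.\<close>

lemma even_card_subgroup_swaps:
  assumes G: "subgroup G Sym" "two_transitive G" and M: "M \<lhd> Sym\<lparr>carrier := G\<rparr>"
    and "even (card M)" "finite M" and xy: "x \<noteq> y"
  shows "\<exists>g\<in>M. g x = y \<and> g y = x"
proof -
  interpret S: group Sym by (rule group_BijGroup)
  have M': "subgroup M Sym" "M \<subseteq> G" and conj: "\<And>g h. g \<in> G \<Longrightarrow> h \<in> M \<Longrightarrow> \<exists>h'\<in>M. g \<circ> h = h' \<circ> g"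
    using M normal_Sym_iff[OF G(1)] by auto
  let ?M = "Sym\<lparr>carrier := M\<rparr>"
  interpret M: group ?M by (rule S.subgroup_imp_group[OF M'(1)])
  obtain m where "card M = 2 * m" using \<open>even (card M)\<close> by blast
  then obtain H where H: "subgroup H ?M" "card H = 2"
    using sylow_thm[of 2 ?M 1 m] \<open>finite M\<close> M.is_group two_is_prime_nat by (auto simp: order_def)
  have H': "subgroup H Sym" "H \<subseteq> M"
    using S.incl_subgroup[OF M'(1) H(1)] subgroup.subset[OF H(1)] by auto
  obtain t where t: "H = {id, t}" "t \<noteq> id"
    using H(2) subgroup_SymD(2)[OF H'(1)] by (auto simp: card_2_iff)
  have "bij t" using subgroup_SymD(1)[OF H'(1)] t by simp
  have "t \<circ> t \<in> H" using subgroup_SymD[OF H'(1)] t by auto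
  moreover have "t \<circ> t \<noteq> t"
    using t(2) bij_is_inj[OF \<open>bij t\<close>] by (auto simp: fun_eq_iff inj_eq)
  ultimately have "t \<circ> t = id" using t(1) by simp
  then have tt: "t (t z) = z" for z by (metis comp_apply id_apply)
  obtain u where u: "t u \<noteq> u" using t(2) by (auto simp: fun_eq_iff)
  obtain g where g: "g \<in> G" "g u = x" "g (t u) = y"
    using G(2) u xy unfolding two_transitive_def by metis
  obtain h where "h \<in> M" "g \<circ> t = h \<circ> g" using conj[OF g(1), of t] t H' by auto
  then have "h (g z) = g (t z)" for z by (metis comp_apply)
  from this[of u] this[of "t u"] have "h x = y" "h y = x" using g tt by auto
  then show ?thesis using \<open>h \<in> M\<close> by blast
qed

section \<open>Affine groups over groups of additive permutations\<close>

text \<open>Additivity is the only trace of semilinearity that the affine and Cayley graph arguments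
  use; explicit semilinear maps enter later.\<close>

definition additive_group :: "('a::field \<Rightarrow> 'a) set \<Rightarrow> bool" where
  "additive_group H \<longleftrightarrow> subgroup H Sym \<and> (\<forall>h\<in>H. additive h)"

lemma additive_groupD:
  assumes "additive_group H"
  shows "subgroup H Sym" "h \<in> H \<Longrightarrow> bij h" "h \<in> H \<Longrightarrow> h (x + y) = h x + h y"
    "h \<in> H \<Longrightarrow> h (x - y) = h x - h y" "h \<in> H \<Longrightarrow> h (- x) = - h x" "h \<in> H \<Longrightarrow> h 0 = 0"
    "h \<in> H \<Longrightarrow> h x = 0 \<longleftrightarrow> x = 0"
proof -
  show "subgroup H Sym" and b: "h \<in> H \<Longrightarrow> bij h"
    using assms subgroup_SymD(1) by (auto simp: additive_group_def)
  show "h \<in> H \<Longrightarrow> h (x + y) = h x + h y" "h \<in> H \<Longrightarrow> h (x - y) = h x - h y"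
    "h \<in> H \<Longrightarrow> h (- x) = - h x" and z: "h \<in> H \<Longrightarrow> h 0 = 0"
    using assms by (auto simp: additive_group_def additive.add additive.diff additive.minus additive.zero)
  show "h \<in> H \<Longrightarrow> h x = 0 \<longleftrightarrow> x = 0"
    using z b by (metis bij_is_inj inj_eq)
qed

lemma affine_group_eq:
  assumes "subgroup H Sym"
  shows "affine_group H = {(\<lambda>x. h x + t) | h t. h \<in> H}"
proof -
  have "bij (\<lambda>x. x + t)" for t :: 'a by (rule bij_plus_right)
  then have "(\<lambda>x. x + t) \<otimes>\<^bsub>Sym\<^esub> h = (\<lambda>x. h x + t)" if "h \<in> H" for h t
    using subgroup_SymD(1)[OF assms that] by (auto simp: Sym_mult carrier_Sym_iff)
  then show ?thesis
    unfolding affine_group_def translation_group_def set_mult_def by auto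
qed

lemma affine_groupE:
  assumes "subgroup H Sym" "g \<in> affine_group H"
  obtains h t where "h \<in> H" "g = (\<lambda>x. h x + t)"
  using assms affine_group_eq by blast

lemma affine_groupI: "subgroup H Sym \<Longrightarrow> h \<in> H \<Longrightarrow> (\<lambda>x. h x + t) \<in> affine_group H"
  using affine_group_eq by blast

lemma translation_in_affine_group:
  assumes "subgroup H Sym"
  shows "(\<lambda>x. x + t) \<in> affine_group H"
  using affine_groupI[OF assms subgroup_SymD(2)[OF assms], of t] by (simp only: id_apply)

lemma subgroup_affine_group:
  fixes H :: "('a::{field,finite} \<Rightarrow> 'a) set"
  assumes H: "additive_group H"
  shows "subgroup (affine_group H) Sym"
proof (rule subgroup_SymI)
  note S = additive_groupD(1)[OF H]
  show "bij g" if g: "g \<in> affine_group H" for g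
  proof -
    obtain h t where "h \<in> H" "g = (\<lambda>x. h x + t)" using S g by (rule affine_groupE)
    then show ?thesis
      using bij_comp[OF additive_groupD(2)[OF H] bij_plus_right] by (simp add: comp_def)
  qed
  show "id \<in> affine_group H" using translation_in_affine_group[OF S, of 0] by (simp add: id_def)
  show "g \<circ> g' \<in> affine_group H" if g: "g \<in> affine_group H" "g' \<in> affine_group H" for g g'
  proof -
    obtain h t where h: "h \<in> H" "g = (\<lambda>x. h x + t)" using S g(1) by (rule affine_groupE)
    obtain h' t' where h': "h' \<in> H" "g' = (\<lambda>x. h' x + t')" using S g(2) by (rule affine_groupE)
    have "g \<circ> g' = (\<lambda>x. (h \<circ> h') x + (h t' + t))"
      using h h' by (simp add: additive_groupD(3)[OF H] fun_eq_iff add.assoc)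
    then show ?thesis
      using affine_groupI[OF S, of "h \<circ> h'"] subgroup_SymD(3)[OF S] h h' by simp
  qed
qed

lemma normal_affine_group:
  fixes G :: "('a::{field,finite} \<Rightarrow> 'a) set"
  assumes G: "additive_group G" and M: "additive_group M" and normal: "M \<lhd> Sym\<lparr>carrier := G\<rparr>"
  shows "affine_group M \<lhd> Sym\<lparr>carrier := affine_group G\<rparr>"
proof -
  note SG = additive_groupD(1)[OF G] and SM = additive_groupD(1)[OF M]
  have conj: "M \<subseteq> G" "\<And>g h. g \<in> G \<Longrightarrow> h \<in> M \<Longrightarrow> \<exists>h'\<in>M. g \<circ> h = h' \<circ> g"
    using normal normal_Sym_iff[OF SG] by auto
  have "\<exists>b'\<in>affine_group M. a \<circ> b = b' \<circ> a" if ab: "a \<in> affine_group G" "b \<in> affine_group M" for a b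
  proof -
    obtain g t where g: "g \<in> G" "a = (\<lambda>x. g x + t)" using SG ab(1) by (rule affine_groupE)
    obtain h u where h: "h \<in> M" "b = (\<lambda>x. h x + u)" using SM ab(2) by (rule affine_groupE)
    obtain h' where h': "h' \<in> M" "g \<circ> h = h' \<circ> g" using conj(2) g h by blast
    \<comment> \<open>The translation part solves
      \<open>h' (g x + t) + w = h' (g x) + g u + t\<close> for \<open>w\<close>.\<close>
    have "a \<circ> b = (\<lambda>x. h' x + (g u + t - h' t)) \<circ> a"
    proof
      show "(a \<circ> b) x = ((\<lambda>x. h' x + (g u + t - h' t)) \<circ> a) x" for x
        using g h fun_cong[OF h'(2), of x]
        by (simp add: additive_groupD(3)[OF G] additive_groupD(3)[OF M h'(1)])
    qed
    then show ?thesis by (rule bexI[OF _ affine_groupI[OF SM h'(1)]])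
  qed
  moreover have "affine_group M \<subseteq> affine_group G"
    using conj(1) affine_group_eq[OF SG] affine_group_eq[OF SM] by blast
  ultimately show ?thesis
    using normal_Sym_iff[OF subgroup_affine_group[OF G]] subgroup_affine_group[OF M] by blast
qed

lemma two_transitive_affine_group:
  assumes H: "additive_group H" and trans: "transitive_on H nonzero"
  shows "two_transitive (affine_group H)"
  unfolding two_transitive_def
proof (intro allI impI)
  fix u v x y :: 'a
  assume "u \<noteq> v" "x \<noteq> y"
  then have "v - u \<in> nonzero" "y - x \<in> nonzero" by auto
  then obtain h where h: "h \<in> H" "h (v - u) = y - x"
    using trans unfolding transitive_on_def by blast
  \<comment> \<open>The linear part \<open>h\<close> matches the differences; the translation is
    then forced by sending \<open>u\<close> to \<open>x\<close>.\<close>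
  let ?g = "\<lambda>z. h z + (x - h u)"
  have "?g \<in> affine_group H" using affine_groupI[OF additive_groupD(1)[OF H] h(1)] .
  moreover have "?g u = x" "?g v = y"
    using h additive_groupD(4)[OF H h(1), of v u] by (auto simp: algebra_simps)
  ultimately show "\<exists>g\<in>affine_group H. g u = x \<and> g v = y" by (intro bexI[of _ ?g] conjI)
qed

lemma card_affine_group:
  assumes "additive_group H"
  shows "card (affine_group H :: ('a::{field,finite} \<Rightarrow> 'a) set) = CARD('a) * card H"
proof -
  have "affine_group H = (\<lambda>(h, t) x. h x + t) ` (H \<times> UNIV)"
    using affine_group_eq[OF additive_groupD(1)[OF assms]] by auto
  moreover have "inj_on (\<lambda>(h, t) x. h x + t) (H \<times> UNIV)"
  proof (rule inj_onI, clarify)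
    fix h t h' t'
    assume "h \<in> H" "h' \<in> H" and eq: "(\<lambda>x. h x + t) = (\<lambda>x. h' x + t')"
    then have "t = t'"
      using fun_cong[OF eq, of 0] by (simp add: additive_groupD(6)[OF assms])
    with eq show "h = h' \<and> t = t'" by (auto simp: fun_eq_iff)
  qed
  ultimately show ?thesis by (simp add: card_image card_cartesian_product)
qed

lemma transitive_affine_group: "subgroup H Sym \<Longrightarrow> transitive_on (affine_group H) UNIV"
  unfolding transitive_on_def
  by (metis translation_in_affine_group add.commute diff_add_cancel)

section \<open>Orbits and Cayley graphs\<close>

abbreviation orbit_of :: "('a \<Rightarrow> 'a) set \<Rightarrow> 'a \<Rightarrow> 'a set" where
  "orbit_of H x \<equiv> (\<lambda>h. h x) ` H"

lemma orbit_of_refl: "subgroup H Sym \<Longrightarrow> x \<in> orbit_of H x"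
  by (metis id_apply imageI subgroup_SymD(2))

lemma orbit_of_sym:
  assumes "subgroup H Sym" "y \<in> orbit_of H x"
  shows "x \<in> orbit_of H y"
proof -
  obtain h where h: "h \<in> H" "y = h x" using assms by auto
  then have "x = inv_into UNIV h y" using subgroup_SymD(1)[OF assms(1)] by (simp add: bij_is_inj)
  then show ?thesis using subgroup_SymD(4)[OF assms(1) h(1)] by blast
qed

lemma orbit_of_eq:
  assumes H: "subgroup H Sym" and y: "y \<in> orbit_of H x"
  shows "orbit_of H y = orbit_of H x"
proof -
  have "orbit_of H y \<subseteq> orbit_of H x" if yx: "y \<in> orbit_of H x" for x y
  proof clarify
    fix g assume "g \<in> H"
    moreover obtain h where "h \<in> H" "y = h x" using yx by blast
    ultimately have "g \<circ> h \<in> H" "g y = (g \<circ> h) x" using subgroup_SymD(3)[OF H] by auto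
    then show "g y \<in> orbit_of H x" by blast
  qed
  then show ?thesis using y orbit_of_sym[OF H y] by blast
qed

text \<open>Normality gives one inclusion for every element of \<open>G\<close>; the same inclusion
  for the inverse of \<open>g\<close> gives the other.\<close>

lemma image_orbit_of:
  assumes G: "subgroup G Sym" and normal: "M \<lhd> Sym\<lparr>carrier := G\<rparr>" and g: "g \<in> G"
  shows "g ` orbit_of M x = orbit_of M (g x)"
proof -
  have conj: "subgroup M Sym" "M \<subseteq> G" "\<And>g h. g \<in> G \<Longrightarrow> h \<in> M \<Longrightarrow> \<exists>h'\<in>M. g \<circ> h = h' \<circ> g"
    using normal normal_Sym_iff[OF G] by auto
  have sub: "g ` orbit_of M x \<subseteq> orbit_of M (g x)" if g: "g \<in> G" for g x
  proof clarify
    fix h assume "h \<in> M"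
    then obtain h' where "h' \<in> M" "g \<circ> h = h' \<circ> g" using conj(3)[OF g] by blast
    then show "g (h x) \<in> orbit_of M (g x)" by (metis comp_apply imageI)
  qed
  let ?g' = "inv_into UNIV g"
  have bij: "bij g" using subgroup_SymD(1)[OF G g] .
  have "?g' ` orbit_of M (g x) \<subseteq> orbit_of M (?g' (g x))"
    using sub[OF subgroup_SymD(4)[OF G g]] .
  then have "g ` ?g' ` orbit_of M (g x) \<subseteq> g ` orbit_of M x"
    using bij by (simp add: bij_is_inj image_mono)
  then show ?thesis
    using sub[OF g, of x] bij by (simp add: image_f_inv_f bij_is_surj subset_antisym)
qed

text \<open>An unordered edge may be witnessed by either difference; closure under negation makes
  the two agree.\<close>

lemma cayley_edge_iff:
  assumes "\<And>x. x \<in> S \<Longrightarrow> - x \<in> S"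
  shows "{u, v} \<in> cayley_edges S \<longleftrightarrow> v - u \<in> S"
  using assms[of "u - v"] assms[of "v - u"]
  by (auto simp: cayley_edges_def doubleton_eq_iff)

text \<open>Translations cancel in differences, so only the linear part acts on connection
  sets.\<close>

lemma edge_image_cayley_edges:
  assumes H: "additive_group H" and h: "h \<in> H"
  shows "edge_image (\<lambda>x. h x + t) (cayley_edges S) = cayley_edges (h ` S)"
proof (intro equalityI subsetI)
  fix e assume "e \<in> edge_image (\<lambda>x. h x + t) (cayley_edges S)"
  then obtain u v where "v - u \<in> S" "e = {h u + t, h v + t}"
    by (auto simp: edge_image_def cayley_edges_def)
  moreover from this have "(h v + t) - (h u + t) \<in> h ` S"
    using additive_groupD(4)[OF H h, of v u] by force
  ultimately show "e \<in> cayley_edges (h ` S)" unfolding cayley_edges_def by blast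
next
  fix e assume "e \<in> cayley_edges (h ` S)"
  then obtain u v s where e: "v - u = h s" "s \<in> S" "e = {u, v}"
    by (auto simp: cayley_edges_def)
  \<comment> \<open>\<open>x\<close> is chosen so that the affine map sends it to
    \<open>u\<close>.\<close>
  obtain x where x: "h x = u - t" using additive_groupD(2)[OF H h] by (metis bij_pointE)
  have "e = (\<lambda>x. h x + t) ` {x, x + s}"
    using e x additive_groupD(3)[OF H h, of x s] by (auto simp: algebra_simps)
  moreover have "{x, x + s} \<in> cayley_edges S"
    using e(2) unfolding cayley_edges_def by (intro CollectI exI[of _ x] exI[of _ "x + s"]) simp
  ultimately show "e \<in> edge_image (\<lambda>x. h x + t) (cayley_edges S)"
    unfolding edge_image_def by (rule image_eqI)
qed

lemma partition_orbits:
  assumes H: "additive_group H"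
  shows "partition_on nonzero (orbits_on H nonzero)"
proof -
  note S = additive_groupD(1)[OF H]
  have "\<Union> (orbits_on H nonzero) = nonzero"
    using orbit_of_refl[OF S] additive_groupD(7)[OF H] by (force simp: orbits_on_def)
  moreover have "disjoint (orbits_on H nonzero)"
  proof (rule disjointI)
    fix A B assume AB: "A \<in> orbits_on H nonzero" "B \<in> orbits_on H nonzero" "A \<noteq> B"
    then obtain x y where xy: "A = orbit_of H x" "B = orbit_of H y" by (auto simp: orbits_on_def)
    have "A = B" if "z \<in> A" "z \<in> B" for z
      using orbit_of_eq[OF S, of z x] orbit_of_eq[OF S, of z y] that xy by simp
    then show "A \<inter> B = {}" using AB(3) by blast
  qed
  moreover have "{} \<notin> orbits_on H nonzero"
    using subgroup_SymD(2)[OF S] by (auto simp: orbits_on_def)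
  ultimately show ?thesis by (simp add: partition_on_def)
qed

lemma orbits_on_nonzeroE:
  assumes "S \<in> orbits_on H nonzero"
  obtains x where "x \<noteq> 0" "S = orbit_of H x"
  using assms by (auto simp: orbits_on_def)

lemma orbits_on_nonzeroI: "x \<noteq> 0 \<Longrightarrow> orbit_of H x \<in> orbits_on H nonzero"
  by (auto simp: orbits_on_def)

text \<open>Evenness is imposed on \<open>affine_group M0\<close>, of order
  \<open>CARD('a) * card M0\<close>. This one hypothesis covers characteristic 2, where the
  translations supply it, and odd characteristic, where \<open>M0\<close> must.\<close>

locale orbit_factorisation =
  fixes G0 M0 :: "('a::{field,finite} \<Rightarrow> 'a) set"
  assumes G0: "additive_group G0" and M0: "additive_group M0"
    and normal: "M0 \<lhd> Sym\<lparr>carrier := G0\<rparr>"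
    and trans: "transitive_on G0 nonzero" and intrans: "\<not> transitive_on M0 nonzero"
    and even_card: "even (card (affine_group M0))"
begin

text \<open>A map in \<open>affine_group M0\<close> that swaps 0 and \<open>x\<close> has
  translation part \<open>x\<close>, so its linear part in \<open>M0\<close> sends \<open>x\<close>
  to \<open>- x\<close>.\<close>

lemma uminus_mem_orbit:
  assumes S: "S \<in> orbits_on M0 nonzero" and x: "x \<in> S"
  shows "- x \<in> S"
proof (cases "x = 0")
  case False
  obtain y where y: "S = orbit_of M0 y" using S by (rule orbits_on_nonzeroE)
  have "\<exists>g\<in>affine_group M0. g x = 0 \<and> g 0 = x"
    by (rule even_card_subgroup_swaps[OF subgroup_affine_group[OF G0]
          two_transitive_affine_group[OF G0 trans] normal_affine_group[OF G0 M0 normal] even_card])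
      (use False in auto)
  then obtain g where g: "g \<in> affine_group M0" "g x = 0" "g 0 = x" by blast
  obtain h t where h: "h \<in> M0" "g = (\<lambda>x. h x + t)"
    using additive_groupD(1)[OF M0] g(1) by (rule affine_groupE)
  then have "h x = - x"
    using g additive_groupD(6)[OF M0 h(1)] by (simp add: add_eq_0_iff2)
  then have "- x \<in> orbit_of M0 x" using h(1) by (metis imageI)
  then show ?thesis using orbit_of_eq[OF additive_groupD(1)[OF M0]] x y by blast
qed (use x in simp)

lemma edge_iff: "S \<in> orbits_on M0 nonzero \<Longrightarrow> {u, v} \<in> cayley_edges S \<longleftrightarrow> v - u \<in> S"
  using cayley_edge_iff uminus_mem_orbit by metis

lemma orbit_nonzero: "S \<in> orbits_on M0 nonzero \<Longrightarrow> 0 \<notin> S"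
  using partition_onD1[OF partition_orbits[OF M0]] by blast

lemma sym_cayley_arcs: "S \<in> orbits_on M0 nonzero \<Longrightarrow> sym (cayley_arcs S)"
  using uminus_mem_orbit by (force simp: sym_def cayley_arcs_def)

lemma inj_cayley_edges: "inj_on cayley_edges (orbits_on M0 nonzero)"
proof (rule inj_onI)
  fix S S' assume "S \<in> orbits_on M0 nonzero" "S' \<in> orbits_on M0 nonzero" "cayley_edges S = cayley_edges S'"
  \<comment> \<open>The edges through 0 recover the connection set.\<close>
  then show "S = S'" using edge_iff[of S 0] edge_iff[of S' 0] by auto
qed

lemma card_orbit_factors: "card (orbit_factors M0) = card (orbits_on M0 nonzero)"
  unfolding orbit_factors_def by (rule card_image[OF inj_cayley_edges])

lemma partition_orbit_factors: "partition_on complete_edges (orbit_factors M0)"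
proof -
  have sub: "cayley_edges S \<subseteq> complete_edges" if S: "S \<in> orbits_on M0 nonzero" for S
    using orbit_nonzero[OF S] by (auto simp: cayley_edges_def complete_edges_def card_insert_if)
  moreover have "e \<in> \<Union> (orbit_factors M0)" if edge: "e \<in> complete_edges" for e
  proof -
    obtain u v where e: "e = {u, v}" "u \<noteq> v"
      using edge by (auto simp: complete_edges_def card_2_iff)
    let ?S = "orbit_of M0 (v - u)"
    have "?S \<in> orbits_on M0 nonzero" using e by (intro orbits_on_nonzeroI) auto
    moreover have "e \<in> cayley_edges ?S"
      using orbit_of_refl[OF additive_groupD(1)[OF M0]] e unfolding cayley_edges_def by blast
    ultimately show ?thesis by (auto simp: orbit_factors_def)
  qed
  ultimately have "\<Union> (orbit_factors M0) = complete_edges"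
    by (auto simp: orbit_factors_def)
  moreover have "disjoint (orbit_factors M0)"
  proof (rule disjointI)
    fix E E' assume "E \<in> orbit_factors M0" "E' \<in> orbit_factors M0" "E \<noteq> E'"
    then obtain S S' where S: "S \<in> orbits_on M0 nonzero" "E = cayley_edges S"
      "S' \<in> orbits_on M0 nonzero" "E' = cayley_edges S'" "S \<noteq> S'"
      by (auto simp: orbit_factors_def)
    then have "S \<inter> S' = {}"
      using partition_onD2[OF partition_orbits[OF M0]] by (auto simp: disjoint_def)
    moreover have "\<exists>x. x \<in> S \<and> x \<in> S'" if e: "e \<in> E" "e \<in> E'" for e
    proof -
      obtain u v where "e = {u, v}" using e(1) S(2) by (auto simp: cayley_edges_def)
      then show ?thesis using e S edge_iff[OF S(1), of u v] edge_iff[OF S(3), of u v] by auto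
    qed
    ultimately show "E \<inter> E' = {}" by blast
  qed
  moreover have "E \<noteq> {}" if E: "E \<in> orbit_factors M0" for E
  proof -
    obtain S where S: "S \<in> orbits_on M0 nonzero" "E = cayley_edges S"
      using E by (auto simp: orbit_factors_def)
    then obtain x where "x \<in> S" using partition_onD3[OF partition_orbits[OF M0]] by fastforce
    then have "{0, x} \<in> E" using edge_iff[OF S(1), of 0 x] S by simp
    then show ?thesis by blast
  qed
  ultimately show ?thesis by (auto simp: partition_on_def)
qed

lemma image_orbit:
  assumes "g \<in> G0" "S \<in> orbits_on M0 nonzero"
  shows "g ` S \<in> orbits_on M0 nonzero"
proof -
  obtain x where x: "x \<noteq> 0" "S = orbit_of M0 x" using assms(2) by (rule orbits_on_nonzeroE)
  have "g ` S = orbit_of M0 (g x)"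
    using image_orbit_of[OF additive_groupD(1)[OF G0] normal assms(1)] x by simp
  then show ?thesis using orbits_on_nonzeroI[of "g x"] additive_groupD(7)[OF G0 assms(1)] x by simp
qed

lemma orbits_conjugate:
  assumes "S \<in> orbits_on M0 nonzero" "S' \<in> orbits_on M0 nonzero"
  shows "\<exists>g\<in>G0. g ` S = S'"
proof -
  obtain x where x: "x \<noteq> 0" "S = orbit_of M0 x" using assms(1) by (rule orbits_on_nonzeroE)
  obtain y where y: "y \<noteq> 0" "S' = orbit_of M0 y" using assms(2) by (rule orbits_on_nonzeroE)
  have "x \<in> nonzero" "y \<in> nonzero" using x y by auto
  then obtain g where g: "g \<in> G0" "g x = y"
    using trans unfolding transitive_on_def by blast
  then have "g ` S = S'"
    using image_orbit_of[OF additive_groupD(1)[OF G0] normal] x y by metis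
  then show ?thesis using g by blast
qed

lemma card_orbits_times_card_orbit:
  assumes "S \<in> orbits_on M0 nonzero"
  shows "card (orbits_on M0 nonzero) * card S = CARD('a) - 1"
proof -
  have "card S' = card S" if S': "S' \<in> orbits_on M0 nonzero" for S'
  proof -
    obtain g where g: "g \<in> G0" "g ` S = S'" using orbits_conjugate[OF assms S'] by blast
    then have "inj_on g S" using additive_groupD(2)[OF G0 g(1)] by (meson bij_is_inj inj_on_subset subset_UNIV)
    then show ?thesis using g(2) card_image by blast
  qed
  moreover have "card (nonzero :: 'a set) = (\<Sum>S'\<in>orbits_on M0 nonzero. card S')"
    using partition_orbits[OF M0] by (intro product_partition) auto
  ultimately show ?thesis by (simp add: card_Diff_singleton)
qed

lemma affine_group_M0_fixes:
  assumes "g \<in> affine_group M0" "S \<in> orbits_on M0 nonzero"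
  shows "edge_image g (cayley_edges S) = cayley_edges S"
proof -
  note SM = additive_groupD(1)[OF M0]
  obtain h t where h: "h \<in> M0" "g = (\<lambda>x. h x + t)" using SM assms(1) by (rule affine_groupE)
  obtain x where x: "x \<noteq> 0" "S = orbit_of M0 x" using assms(2) by (rule orbits_on_nonzeroE)
  have "M0 \<subseteq> G0" using normal normal_Sym_iff[OF additive_groupD(1)[OF G0]] by auto
  then have "h ` S = orbit_of M0 (h x)"
    using image_orbit_of[OF additive_groupD(1)[OF G0] normal] h(1) x by blast
  also have "\<dots> = S" using orbit_of_eq[OF SM] h(1) x by blast
  finally show ?thesis using edge_image_cayley_edges[OF M0 h(1)] h(2) by simp
qed

lemma arc_transitive_cayley_edges:
  assumes S: "S \<in> orbits_on M0 nonzero"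
  shows "arc_transitive (affine_group M0) (cayley_edges S)"
proof -
  note SM = additive_groupD(1)[OF M0]
  have "\<exists>g\<in>affine_group M0. g u = x \<and> g v = y"
    if uv: "{u, v} \<in> cayley_edges S" and xy: "{x, y} \<in> cayley_edges S" for u v x y
  proof -
    have "v - u \<in> S" "y - x \<in> S" using uv xy edge_iff[OF S] by auto
    moreover obtain z where "S = orbit_of M0 z" using S by (rule orbits_on_nonzeroE)
    ultimately have "y - x \<in> orbit_of M0 (v - u)" using orbit_of_eq[OF SM] by blast
    then obtain h where h: "h \<in> M0" "h (v - u) = y - x" by auto
    let ?g = "\<lambda>z. h z + (x - h u)"
    have "?g \<in> affine_group M0" using affine_groupI[OF SM h(1)] .
    moreover have "?g u = x" "?g v = y"
      using h additive_groupD(4)[OF M0 h(1), of v u] by (auto simp: algebra_simps)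
    ultimately show ?thesis by (intro bexI[of _ ?g] conjI)
  qed
  then show ?thesis using affine_group_M0_fixes[OF _ S] unfolding arc_transitive_def by blast
qed

lemma transitive_factorisation_orbits:
  "transitive_factorisation (affine_group G0) (orbit_factors M0) (card (orbits_on M0 nonzero))"
proof -
  note SG = additive_groupD(1)[OF G0] and SM = additive_groupD(1)[OF M0]
  let ?O = "orbits_on M0 nonzero"
  have "?O \<noteq> {}" using orbits_on_nonzeroI[of 1 M0] by auto
  \<comment> \<open>A single orbit would make \<open>M0\<close> transitive.\<close>
  moreover have "card ?O \<noteq> 1"
  proof
    assume "card ?O = 1"
    then obtain S where "?O = {S}" by (auto simp: card_1_singleton_iff)
    then have orbit: "orbit_of M0 x = S" if "x \<noteq> 0" for x using orbits_on_nonzeroI[OF that, of M0] by auto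
    have "y \<in> orbit_of M0 x" if "x \<noteq> 0" "y \<noteq> 0" for x y
      using orbit_of_refl[OF SM, of y] orbit[OF that(1)] orbit[OF that(2)] by simp
    then have "\<exists>h\<in>M0. h x = y" if "x \<noteq> 0" "y \<noteq> 0" for x y
      using that by (metis (no_types, lifting) imageE)
    then have "transitive_on M0 nonzero" by (simp add: transitive_on_def)
    then show False using intrans by simp
  qed
  ultimately have "card ?O > 1" using card_gt_0_iff[of ?O] by simp
  moreover have image: "edge_image g ` orbit_factors M0 \<subseteq> orbit_factors M0"
    if g: "g \<in> affine_group G0" for g
  proof -
    obtain h t where h: "h \<in> G0" "g = (\<lambda>x. h x + t)" using SG g by (rule affine_groupE)
    then show ?thesis
      using image_orbit[OF h(1)] edge_image_cayley_edges[OF G0 h(1)] by (auto simp: orbit_factors_def)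
  qed
  \<comment> \<open>The inclusion becomes an equality because the action on edge sets is injective
    and there are finitely many factors.\<close>
  moreover have "edge_image g ` orbit_factors M0 = orbit_factors M0"
    if g: "g \<in> affine_group G0" for g
  proof (intro card_subset_eq image[OF g] card_image)
    have "inj (edge_image g)"
      using subgroup_SymD(1)[OF subgroup_affine_group[OF G0] g]
      by (simp add: edge_image_def inj_def[of "edge_image g"] bij_is_inj inj_image_eq_iff inj_on_image)
    then show "inj_on (edge_image g) (orbit_factors M0)" by (rule inj_on_subset) simp
  qed simp
  moreover have "\<exists>g\<in>affine_group G0. edge_image g E = E'"
    if E: "E \<in> orbit_factors M0" "E' \<in> orbit_factors M0" for E E'
  proof -
    obtain S S' where S: "S \<in> ?O" "S' \<in> ?O" "E = cayley_edges S" "E' = cayley_edges S'"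
      using E by (auto simp: orbit_factors_def)
    then obtain h where h: "h \<in> G0" "h ` S = S'" using orbits_conjugate by blast
    then have "edge_image (\<lambda>x. h x + 0) E = E'"
      using edge_image_cayley_edges[OF G0 h(1), of 0 S] S by simp
    then show ?thesis by (rule bexI[OF _ affine_groupI[OF SG h(1)]])
  qed
  ultimately show ?thesis
    unfolding transitive_factorisation_def
    using partition_orbit_factors card_orbit_factors subgroup_affine_group[OF G0]
      transitive_affine_group[OF SG] by simp
qed

lemma affine_group_M0_subset_kernel:
  "affine_group M0 \<subseteq> factor_kernel (affine_group G0) (orbit_factors M0)"
proof -
  have "affine_group M0 \<subseteq> affine_group G0"
    using normal_affine_group[OF G0 M0 normal] normal_Sym_iff[OF subgroup_affine_group[OF G0]] by blast
  then show ?thesis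
    using affine_group_M0_fixes by (auto simp: factor_kernel_def orbit_factors_def)
qed

lemma weak_homogeneous_factorisation_orbits:
  "weak_homogeneous_factorisation (affine_group M0) (affine_group G0) (orbit_factors M0)
     (card (orbits_on M0 nonzero))"
  unfolding weak_homogeneous_factorisation_def
  using transitive_factorisation_orbits normal_affine_group[OF G0 M0 normal]
    affine_group_M0_subset_kernel transitive_affine_group[OF additive_groupD(1)[OF M0]] by blast

text \<open>The kernel may be larger than \<open>affine_group M0\<close>, but it contains that group
  and so inherits its transitivity.\<close>

lemma homogeneous_factorisation_orbits:
  "homogeneous_factorisation (factor_kernel (affine_group G0) (orbit_factors M0)) (affine_group G0)
     (orbit_factors M0) (card (orbits_on M0 nonzero))"
  unfolding homogeneous_factorisation_def
  using transitive_factorisation_orbits affine_group_M0_subset_kernel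
    transitive_affine_group[OF additive_groupD(1)[OF M0]]
  unfolding transitive_on_def by blast

end

section \<open>Semilinear maps\<close>

text \<open>This sum stands in for the quotient (m^j - 1)/(m - 1): its recursions involve no
  truncated subtraction or division.\<close>

definition geometric :: "nat \<Rightarrow> nat \<Rightarrow> nat" where
  "geometric m j = (\<Sum>i<j. m ^ i)"

lemma geometric_0 [simp]: "geometric m 0 = 0"
  by (simp add: geometric_def)

lemma geometric_Suc: "geometric m (Suc j) = 1 + m * geometric m j"
  unfolding geometric_def by (subst sum.lessThan_Suc_shift) (simp add: sum_distrib_left)

lemma geometric_add: "geometric m (i + j) = geometric m i + m ^ i * geometric m j"
  by (induction i) (simp_all add: geometric_Suc algebra_simps)

lemma geometric_eq_div:
  assumes "m > 1"
  shows "geometric m j = (m ^ j - 1) div (m - 1)"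
proof -
  obtain k where k: "m = Suc k" using assms by (cases m) auto
  have "geometric m j * k + 1 = m ^ j"
  proof (induction j)
    case (Suc j)
    then have "m ^ Suc j = (geometric m j * k + 1) * m" by simp
    then show ?case by (simp add: geometric_Suc k algebra_simps)
  qed simp
  then have "geometric m j * (m - 1) + 1 = m ^ j" using k by simp
  then show ?thesis using assms by (metis add_diff_cancel_right' div_mult_self_is_m zero_less_diff)
qed

section \<open>Powers of the primitive element\<close>

locale finite_field_generator =
  fixes p R :: nat and \<omega> :: "'a::{field,finite}"
  assumes prime_p: "prime p" and R_pos: "R \<ge> 1" and card_field: "CARD('a) = p ^ R"
    and primitive: "primitive_element \<omega>"
begin

lemma power_nonzero_range: "range (\<lambda>n::nat. \<omega> ^ n) = nonzero"
  using primitive by (simp add: primitive_element_def)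

lemma omega_nonzero [simp]: "\<omega> \<noteq> 0"
proof -
  have "\<omega> ^ 1 \<in> nonzero" using power_nonzero_range by blast
  then show ?thesis by simp
qed

lemma nonzero_is_power: "x \<noteq> 0 \<Longrightarrow> \<exists>n. x = \<omega> ^ n"
  using power_nonzero_range by blast

text \<open>Primitivity says only that the powers of \<omega> cover the nonzero elements. The least
  positive period \<open>m\<close> is found by counting: the powers below \<open>m\<close> are
  distinct and already cover, so \<open>m\<close> is \<open>p ^ R - 1\<close>.\<close>

lemma omega_power_eq_1_iff: "\<omega> ^ a = 1 \<longleftrightarrow> p ^ R - 1 dvd a"
proof -
  \<comment> \<open>A finite field has too few elements for all powers to differ, so a period
    exists.\<close>
  have "\<not> inj (\<lambda>n::nat. \<omega> ^ n)" using finite_imageD[of "\<lambda>n::nat. \<omega> ^ n" UNIV] by auto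
  then obtain i j :: nat where "\<omega> ^ i = \<omega> ^ j" "i < j"
    unfolding inj_def by (metis linorder_neqE_nat)
  then have "\<omega> ^ (j - i) = 1" by (simp add: power_diff)
  then have ex: "\<exists>m>0. \<omega> ^ m = 1" using \<open>i < j\<close> zero_less_diff by blast
  define m where "m = (LEAST m. m > 0 \<and> \<omega> ^ m = 1)"
  have m: "m > 0" "\<omega> ^ m = 1" using LeastI_ex[OF ex] by (auto simp: m_def)
  have least: "k = 0" if "k < m" "\<omega> ^ k = 1" for k
    using not_less_Least[of k "\<lambda>m. m > 0 \<and> \<omega> ^ m = 1"] that by (auto simp: m_def)
  have red: "\<omega> ^ k = \<omega> ^ (k mod m)" for k
  proof -
    have "\<omega> ^ k = \<omega> ^ (m * (k div m) + k mod m)" by simp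
    also have "\<dots> = \<omega> ^ (k mod m)" by (simp only: power_add power_mult m) simp
    finally show ?thesis .
  qed
  have "nonzero = (\<lambda>n. \<omega> ^ n) ` {..<m}"
  proof -
    have "range (\<lambda>n. \<omega> ^ n) \<subseteq> (\<lambda>n. \<omega> ^ n) ` {..<m}"
      using red m(1) by (metis image_subsetI imageI lessThan_iff mod_less_divisor)
    then show ?thesis using power_nonzero_range by blast
  qed
  moreover have "inj_on (\<lambda>n. \<omega> ^ n) {..<m}"
  proof (rule linorder_inj_onI)
    fix a b assume ab: "a < b" "b \<in> {..<m}"
    show "\<omega> ^ a \<noteq> \<omega> ^ b"
    proof
      assume "\<omega> ^ a = \<omega> ^ b"
      then have "\<omega> ^ (b - a) = 1" using ab by (simp add: power_diff)
      then show False using least[of "b - a"] ab by (simp add: less_imp_diff_less)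
    qed
  qed auto
  ultimately have "card (nonzero :: 'a set) = m" by (simp add: card_image)
  then have mq: "m = p ^ R - 1" using card_field by (simp add: card_Diff_singleton)
  show ?thesis
  proof
    assume "\<omega> ^ a = 1"
    then have "a mod m = 0" using red[of a] least[of "a mod m"] m(1) by simp
    then show "p ^ R - 1 dvd a" using mq by auto
  next
    assume "p ^ R - 1 dvd a"
    then show "\<omega> ^ a = 1" using m mq by (auto simp: power_mult elim!: dvdE)
  qed
qed

lemma omega_power_cong_iff: "\<omega> ^ a = \<omega> ^ b \<longleftrightarrow> [a = b] (mod p ^ R - 1)"
proof -
  have "\<omega> ^ a = \<omega> ^ b \<longleftrightarrow> [a = b] (mod p ^ R - 1)" if "a \<le> b" for a b
  proof -
    have "\<omega> ^ a = \<omega> ^ b \<longleftrightarrow> \<omega> ^ (b - a) = 1" using that by (auto simp: power_diff)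
    also have "\<dots> \<longleftrightarrow> [a = b] (mod p ^ R - 1)"
      using that cong_altdef_nat[of a b "p ^ R - 1"] cong_sym_eq[of a b] by (simp add: omega_power_eq_1_iff)
    finally show ?thesis .
  qed
  from this[of a b] this[of b a] show ?thesis by (metis cong_sym_eq nat_le_linear)
qed

section \<open>Field size, characteristic and Frobenius powers\<close>

lemma field_size_gt_1: "p ^ R > 1"
  using prime_gt_1_nat[OF prime_p] R_pos by (intro one_less_power) auto

lemma power_field_size: "x ^ (p ^ R) = x" for x :: 'a
proof (cases "x = 0")
  case False
  then obtain n where n: "x = \<omega> ^ n" using nonzero_is_power by blast
  have "x ^ (p ^ R - 1) = \<omega> ^ (n * (p ^ R - 1))" using n by (simp add: power_mult)
  also have "\<dots> = 1" by (simp add: omega_power_eq_1_iff)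
  finally have "x ^ (p ^ R - 1 + 1) = x" by (simp only: power_add) simp
  moreover have "p ^ R - 1 + 1 = p ^ R" using field_size_gt_1 by simp
  ultimately show ?thesis by (simp only:)
qed (use prime_gt_0_nat[OF prime_p] in simp)

lemma power_field_size_power: "x ^ (p ^ (R * m)) = x" for x :: 'a
  by (induction m) (simp_all add: power_add power_mult power_field_size)

lemma char_field: "CHAR('a) = p"
proof -
  have "prime CHAR('a)" using prime_CHAR_semidom finite_imp_CHAR_pos[where ?'a = 'a] by simp
  moreover have "CHAR('a) dvd p ^ R" using CHAR_dvd_CARD[where ?'a = 'a] card_field by simp
  ultimately show ?thesis using prime_p by (metis prime_dvd_power primes_dvd_imp_eq)
qed

lemma power_p_power_add: "(x + y) ^ (p ^ j) = x ^ (p ^ j) + y ^ (p ^ j)" for x y :: 'a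
  using freshmans_dream'[where ?'a = 'a] char_field prime_p by simp

text \<open>First the \<open>b\<close>-th Frobenius power, then multiplication by the
  \<open>a\<close>-th power of \<omega>. The natural exponents represent classes modulo
  \<open>p ^ R - 1\<close> and modulo \<open>R\<close>.\<close>

definition semi :: "nat \<Rightarrow> nat \<Rightarrow> 'a \<Rightarrow> 'a" where
  "semi a b = (\<lambda>x. \<omega> ^ a * x ^ (p ^ b))"

lemma semi_comp: "semi a b \<circ> semi a' b' = semi (a + a' * p ^ b) (b + b')"
  by (auto simp: semi_def fun_eq_iff power_mult_distrib power_add mult.commute simp flip: power_mult)

lemma semi_0_0: "semi 0 0 = id"
  by (auto simp: semi_def)

lemma semi_reduce_right: "semi a (b + R * m) = semi a b"
  by (simp add: semi_def power_add power_mult power_field_size_power fun_eq_iff)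
    (metis power_field_size_power power_mult)

lemma semi_cong_left: "[a = a'] (mod p ^ R - 1) \<Longrightarrow> semi a b = semi a' b"
  unfolding semi_def by (simp only: omega_power_cong_iff[symmetric])

lemma additive_semi: "additive (semi a b)"
  by unfold_locales (simp add: semi_def power_p_power_add distrib_left)

lemma bij_semi: "bij (semi a b)"
proof -
  have "inj (semi a b)"
  proof (rule injI)
    fix x y assume "semi a b x = semi a b y"
    \<comment> \<open>Raising further, to the total exponent \<open>p ^ (R * b)\<close>, undoes the
      Frobenius power, since that exponent acts as the identity.\<close>
    then have "(x ^ (p ^ b)) ^ (p ^ (R * b - b)) = (y ^ (p ^ b)) ^ (p ^ (R * b - b))"
      by (simp add: semi_def)
    moreover have "b + (R * b - b) = R * b" using R_pos by simp
    ultimately show "x = y"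
      by (simp add: power_field_size_power flip: power_mult power_add)
  qed
  then show ?thesis by (simp add: bij_def finite_UNIV_inj_surj)
qed

lemma mult_map_funpow: "mult_map \<omega> ^^ e = semi e 0"
  by (induction e) (auto simp: semi_def mult_map_def fun_eq_iff)

lemma frob_funpow: "frob p ^^ s = semi 0 s"
  by (induction s) (auto simp: semi_def frob_def fun_eq_iff simp flip: power_mult, simp add: mult.commute)

text \<open>Multiplication comes first and Frobenius second, so the multiplier is itself raised to
  the power \<open>p ^ s\<close>; hence the exponent \<open>e * p ^ s\<close>.\<close>

lemma semi_generator: "(frob p ^^ s) \<circ> (mult_map \<omega> ^^ e) = semi (e * p ^ s) s"
  by (simp add: mult_map_funpow frob_funpow semi_comp)

text \<open>The exponent of \<omega> in the \<open>j\<close>-th power of the second generator,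
  namely e(p^s + p^(2s) + ... + p^(js)).\<close>

definition twist :: "nat \<Rightarrow> nat \<Rightarrow> nat \<Rightarrow> nat" where
  "twist e s j = e * p ^ s * geometric (p ^ s) j"

lemma twist_0 [simp]: "twist e s 0 = 0"
  by (simp add: twist_def)

lemma twist_1: "twist e s 1 = e * p ^ s"
  by (simp add: twist_def geometric_Suc)

text \<open>The cocycle rule that mirrors \<open>semi_comp\<close>.\<close>

lemma twist_add: "twist e s (i + j) = twist e s i + twist e s j * p ^ (s * i)"
  by (simp add: twist_def geometric_add algebra_simps flip: power_mult)

lemma semi_generator_power: "semi (e * p ^ s) s ^^ j = semi (twist e s j) (s * j)"
proof (induction j)
  case (Suc j)
  have "twist e s (Suc j) = e * p ^ s + twist e s j * p ^ s"
    using twist_add[of e s 1 j] by (simp only: twist_1) simp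
  with Suc show ?case by (simp add: semi_comp)
qed (simp add: semi_0_0)

text \<open>The right-hand side is closed under composition because Frobenius takes exponents
  divisible by \<open>d\<close> to such exponents and \<open>twist\<close> is a cocycle. Finiteness
  supplies the inverses, so natural exponents suffice.\<close>

lemma GammaL1_subgroup_eq:
  "GammaL1_subgroup p \<omega> d e s = {semi (d * i + twist e s j) (s * j) | i j. True}" (is "?H = ?K")
proof -
  interpret S: group Sym by (rule group_BijGroup)
  have gen: "?H = generate Sym {semi d 0, semi (e * p ^ s) s}"
    unfolding GammaL1_subgroup_def semi_generator by (simp add: mult_map_funpow)
  have "subgroup ?K Sym"
  proof (rule subgroup_SymI)
    show "g \<in> ?K \<Longrightarrow> bij g" for g using bij_semi by blast
    have "id = semi (d * 0 + twist e s 0) (s * 0)" by (simp add: semi_0_0)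
    then show "id \<in> ?K" by blast
    show "g \<circ> h \<in> ?K" if gh: "g \<in> ?K" "h \<in> ?K" for g h
    proof -
      obtain i j where g: "g = semi (d * i + twist e s j) (s * j)" using gh(1) by blast
      obtain i' j' where h: "h = semi (d * i' + twist e s j') (s * j')" using gh(2) by blast
      have "g \<circ> h = semi (d * (i + i' * p ^ (s * j)) + twist e s (j + j')) (s * (j + j'))"
        unfolding g h semi_comp twist_add by (simp add: algebra_simps)
      then show ?thesis by blast
    qed
  qed
  moreover have "semi d 0 = semi (d * 1 + twist e s 0) (s * 0)"
    "semi (e * p ^ s) s = semi (d * 0 + twist e s 1) (s * 1)" by (simp, simp only: twist_1) simp
  then have "{semi d 0, semi (e * p ^ s) s} \<subseteq> ?K" by blast
  ultimately have "?H \<subseteq> ?K" unfolding gen using S.generate_subgroup_incl by blast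
  moreover have "?K \<subseteq> ?H"
  proof -
    have sub: "subgroup ?H Sym" unfolding gen
      by (rule S.generate_is_subgroup) (auto simp: carrier_Sym_iff bij_semi)
    have pow: "g ^^ n \<in> ?H" if "g \<in> ?H" for g n
      using that subgroup_SymD(2,3)[OF sub] by (induction n) auto
    have gens: "semi d 0 \<in> ?H" "semi (e * p ^ s) s \<in> ?H"
      unfolding gen by (auto intro: generate.incl)
    have "semi (d * i + twist e s j) (s * j) \<in> ?H" for i j
    proof -
      have "semi d 0 ^^ i = semi (d * i) 0"
        by (induction i) (simp_all add: semi_0_0 semi_comp)
      then have "semi (d * i + twist e s j) (s * j) = (semi d 0 ^^ i) \<circ> (semi (e * p ^ s) s ^^ j)"
        by (simp add: semi_generator_power semi_comp)
      then show ?thesis using pow gens subgroup_SymD(3)[OF sub] by simp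
    qed
    then show ?thesis by blast
  qed
  ultimately show ?thesis by blast
qed

lemma additive_group_GammaL1_subgroup: "additive_group (GammaL1_subgroup p \<omega> d e s)"
proof -
  interpret S: group Sym by (rule group_BijGroup)
  have "subgroup (GammaL1_subgroup p \<omega> d e s) Sym"
    unfolding GammaL1_subgroup_def semi_generator unfolding mult_map_funpow
    by (rule S.generate_is_subgroup) (auto simp: carrier_Sym_iff bij_semi)
  moreover have "additive g" if "g \<in> GammaL1_subgroup p \<omega> d e s" for g
    using that additive_semi unfolding GammaL1_subgroup_eq by blast
  ultimately show ?thesis by (simp add: additive_group_def)
qed

lemma GammaL1_eq: "GammaL1 p \<omega> = {semi a b | a b. True}"
proof -
  have "GammaL1 p \<omega> = GammaL1_subgroup p \<omega> 1 0 1"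
    by (simp add: GammaL1_def GammaL1_subgroup_def)
  then show ?thesis by (simp add: GammaL1_subgroup_eq twist_def)
qed

lemma additive_group_GammaL1: "additive_group (GammaL1 p \<omega>)"
  using additive_group_GammaL1_subgroup[of 1 0 1] by (simp add: GammaL1_def GammaL1_subgroup_def)

text \<open>Exponents reduce modulo \<open>p ^ R - 1\<close> and \<open>R\<close>. The bound will be
  set against the number of ordered pairs of distinct points.\<close>

lemma card_GammaL1_le: "card (GammaL1 p \<omega>) \<le> (p ^ R - 1) * R"
proof -
  have "semi a b = semi (a mod (p ^ R - 1)) (b mod R)" for a b
    using semi_reduce_right[of a "b mod R" "b div R"] semi_cong_left[of a "a mod (p ^ R - 1)"] by simp
  then have "GammaL1 p \<omega> \<subseteq> (\<lambda>(a, b). semi a b) ` ({..<p ^ R - 1} \<times> {..<R})"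
    using field_size_gt_1 R_pos by (fastforce simp: GammaL1_eq image_iff)
  then have "card (GammaL1 p \<omega>) \<le> card ({..<p ^ R - 1} \<times> {..<R})"
    by (meson card_image_le card_mono finite_SigmaI finite_imageI finite_lessThan le_trans)
  then show ?thesis by simp
qed

section \<open>Divisibility in standard form and the orbit of 1\<close>

lemma coprime_divisor_p:
  assumes "d dvd p ^ R - 1"
  shows "coprime d p"
proof -
  have "coprime (p ^ R - 1) (p ^ R)" using field_size_gt_1 by (intro coprime_diff_one_left_nat) linarith
  then have "coprime d (p ^ R)" using assms by (rule coprime_divisors[rotated 2]) simp
  then show ?thesis using R_pos by simp
qed

text \<open>Powers of \<open>p\<close> are units modulo \<open>d\<close> and cancel; the factor
  \<open>p ^ m\<close> is of the kind that \<open>twist_add\<close> produces.\<close>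

lemma dvd_twist_iff:
  assumes "d dvd p ^ R - 1"
  shows "d dvd twist e s j * p ^ m \<longleftrightarrow> d dvd e * geometric (p ^ s) j"
proof -
  have "twist e s j * p ^ m = p ^ (s + m) * (e * geometric (p ^ s) j)"
    by (simp add: twist_def power_add)
  then show ?thesis
    using coprime_divisor_p[OF assms] by (simp add: coprime_dvd_mult_right_iff)
qed

lemma geometric_p_power: "s > 0 \<Longrightarrow> geometric (p ^ s) j = (p ^ (j * s) - 1) div (p ^ s - 1)"
  using geometric_eq_div[of "p ^ s" j] one_less_power[OF prime_gt_1_nat[OF prime_p]]
  by (simp add: mult.commute flip: power_mult)

lemma standard_form_iff:
  "standard_form p R d e s \<longleftrightarrow> d dvd p ^ R - 1 \<and> s > 0 \<and> s dvd R \<and> e < d \<and>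
     d dvd e * geometric (p ^ s) (R div s)"
  using geometric_p_power[of s "R div s"] by (auto simp: standard_form_def cong_0_iff)

lemma merge_length:
  assumes "standard_form p R d e s"
  shows "merge_length p d e s > 0" "d dvd e * geometric (p ^ s) (merge_length p d e s)"
    "0 < j \<Longrightarrow> j < merge_length p d e s \<Longrightarrow> \<not> d dvd e * geometric (p ^ s) j"
proof -
  note std = assms[unfolded standard_form_iff]
  let ?P = "\<lambda>c. c > 0 \<and> d dvd e * geometric (p ^ s) c"
  \<comment> \<open>The value 1 prescribed for \<open>e = 0\<close> is also the least number with
    property \<open>?P\<close>, so one description serves both cases.\<close>
  have ml: "merge_length p d e s = (LEAST c. ?P c)"
  proof (cases "e = 0")
    case True
    have "(LEAST c. ?P c) = 1" by (rule Least_equality) (auto simp: True)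
    then show ?thesis by (simp add: merge_length_def True)
  qed (use std geometric_p_power in \<open>simp add: merge_length_def\<close>)
  \<comment> \<open>The congruence of standard form makes \<open>R div s\<close> a witness, so the
    least number exists.\<close>
  have "?P (R div s)" using std R_pos by (auto elim!: dvdE)
  then have "?P (merge_length p d e s)" unfolding ml by (rule LeastI)
  then show "merge_length p d e s > 0" "d dvd e * geometric (p ^ s) (merge_length p d e s)" by auto
  show "\<not> d dvd e * geometric (p ^ s) j" if "0 < j" "j < merge_length p d e s"
    using not_less_Least[of j ?P] that unfolding ml by blast
qed

text \<open>Modulo \<open>d\<close> the exponent of an orbit point depends only on \<open>j\<close>
  and takes distinct values for \<open>j\<close> below the merge length, then repeats. Each residue
  class contributes (p^R - 1)/d powers of \<omega>.\<close>

lemma card_orbit_of_1: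
  assumes "standard_form p R d e s"
  shows "card (orbit_of (GammaL1_subgroup p \<omega> d e s) 1) * d = (p ^ R - 1) * merge_length p d e s"
proof -
  note std = assms[unfolded standard_form_iff]
  define c where "c = merge_length p d e s"
  have c: "c > 0" "d dvd e * geometric (p ^ s) c"
    and c_least: "\<And>j. 0 < j \<Longrightarrow> j < c \<Longrightarrow> \<not> d dvd e * geometric (p ^ s) j"
    using merge_length[OF assms] by (auto simp: c_def)
  have d: "d dvd p ^ R - 1" "d > 0" using std by auto
  then obtain n where n: "p ^ R - 1 = d * n" by blast
  have "n > 0" using n field_size_gt_1 by (cases n) auto
  define f where "f = (\<lambda>(i, j). \<omega> ^ (d * i + twist e s j))"
  have orbit: "orbit_of (GammaL1_subgroup p \<omega> d e s) 1 = range f"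
  proof (intro equalityI subsetI)
    fix x assume "x \<in> orbit_of (GammaL1_subgroup p \<omega> d e s) 1"
    then obtain i j where "x = semi (d * i + twist e s j) (s * j) 1" by (auto simp: GammaL1_subgroup_eq)
    then have "x = f (i, j)" by (simp add: f_def semi_def)
    then show "x \<in> range f" by blast
  next
    fix x assume "x \<in> range f"
    then obtain i j where "x = semi (d * i + twist e s j) (s * j) 1" by (auto simp: f_def semi_def)
    then show "x \<in> orbit_of (GammaL1_subgroup p \<omega> d e s) 1" unfolding GammaL1_subgroup_eq by blast
  qed
  have c_mult: "d dvd twist e s (c * m)" for m
  proof (induction m)
    case (Suc m)
    have "d dvd twist e s c" using dvd_twist_iff[OF d(1), of e s c 0] c(2) by simp
    then show ?case using Suc twist_add[of e s c "c * m"] by simp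
  qed simp
  have "range f \<subseteq> f ` ({..<n} \<times> {..<c})"
  proof clarify
    fix i j
    let ?r = "j mod c"
    obtain m where m: "twist e s (c * (j div c)) = d * m" using c_mult by blast
    \<comment> \<open>Splitting off a multiple of \<open>c\<close> from \<open>j\<close> yields a
      multiple of \<open>d\<close>, which is absorbed into \<open>?M\<close>; as
      \<open>d * n\<close> is \<open>p ^ R - 1\<close>, only \<open>?M mod n\<close>
      matters.\<close>
    have "twist e s j = twist e s ?r + twist e s (c * (j div c)) * p ^ (s * ?r)"
      using twist_add[of e s ?r "c * (j div c)"] by simp
    then have eq: "d * i + twist e s j = d * (i + m * p ^ (s * ?r)) + twist e s ?r" (is "_ = d * ?M + _")
      using m by (simp add: algebra_simps)
    have "[d * ?M = d * (?M mod n)] (mod d * n)"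
      by (simp only: cong_def mult_mod_right mod_mod_trivial)
    then have "[d * ?M + twist e s ?r = d * (?M mod n) + twist e s ?r] (mod p ^ R - 1)"
      using n by (simp add: cong_add)
    then have "f (i, j) = f (?M mod n, ?r)"
      unfolding f_def by (simp only: prod.case eq omega_power_cong_iff)
    moreover have "(?M mod n, ?r) \<in> {..<n} \<times> {..<c}" using \<open>n > 0\<close> c(1) by simp
    ultimately show "f (i, j) \<in> f ` ({..<n} \<times> {..<c})" by blast
  qed
  then have "range f = f ` ({..<n} \<times> {..<c})" by blast
  moreover have "inj_on f ({..<n} \<times> {..<c})"
  proof -
    have "i = i' \<and> j = j'"
      if "i < n" "i' < n" "j \<le> j'" "j' < c" and eq: "f (i, j) = f (i', j')" for i i' j j'
    proof -
      have cong: "[d * i + twist e s j = d * i' + twist e s j'] (mod d * n)"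
        using eq n by (simp add: f_def omega_power_cong_iff)
      have tw: "twist e s j' = twist e s j + twist e s (j' - j) * p ^ (s * j)"
        using twist_add[of e s j "j' - j"] \<open>j \<le> j'\<close> by simp
      have "[d * i + twist e s j = d * i' + twist e s j'] (mod d)"
        using cong cong_modulus_mult_nat by blast
      then have "[twist e s j = twist e s j'] (mod d)" by (simp add: cong_def)
      \<comment> \<open>Equal residues modulo \<open>d\<close> would make \<open>j' - j\<close>,
        which is below \<open>c\<close>, a smaller return to residue 0 unless it vanishes.\<close>
      then have "d dvd twist e s (j' - j) * p ^ (s * j)"
        unfolding tw by (metis cong_0_iff cong_add_lcancel_0_nat cong_sym_eq)
      then have "j' - j = 0" using c_least[of "j' - j"] dvd_twist_iff[OF d(1)] \<open>j' < c\<close>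
        by (metis bot_nat_0.not_eq_extremum less_imp_diff_less)
      then have j: "j = j'" using \<open>j \<le> j'\<close> by simp
      then have "[d * i = d * i'] (mod d * n)" using cong by (simp add: cong_add_rcancel_nat)
      then have "i mod n = i' mod n" using d(2) by (simp add: cong_def)
      then show ?thesis using that j by simp
    qed
    note inj = this
    show ?thesis
    proof (rule inj_onI)
      fix x y assume xy: "x \<in> {..<n} \<times> {..<c}" "y \<in> {..<n} \<times> {..<c}" "f x = f y"
      obtain i j i' j' where "x = (i, j)" "y = (i', j')" by (cases x, cases y)
      then show "x = y"
        using inj[of i i' j j'] inj[of i' i j' j] xy by (cases "j \<le> j'") auto
    qed
  qed
  ultimately have "card (range f) = n * c" by (simp add: card_image card_cartesian_product)
  then show ?thesis using orbit n by (simp add: c_def mult_ac)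
qed

text \<open>Division with remainder by the least \<open>d\<close> and \<open>s\<close> describes the
  multiplications and the Frobenius exponents in \<open>H\<close>. With natural exponents, factors
  \<open>N - 1\<close> and \<open>R - 1\<close> play the role of -1.\<close>

lemma subgroup_standard_form:
  assumes H: "subgroup H Sym" and sub: "H \<subseteq> GammaL1 p \<omega>"
  shows "\<exists>d e s. standard_form p R d e s \<and> H = GammaL1_subgroup p \<omega> d e s"
proof -
  define N where "N = p ^ R - 1"
  have N: "N > 0" using field_size_gt_1 by (simp add: N_def)
  have comp: "semi (a + a' * p ^ b) (b + b') \<in> H" if "semi a b \<in> H" "semi a' b' \<in> H" for a b a' b'
    using subgroup_SymD(3)[OF H that] by (simp add: semi_comp)
  have comp0: "semi (a + a') b \<in> H" if "semi a 0 \<in> H" "semi a' b \<in> H" for a a' b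
    using comp[OF that] by simp
  have mult0: "semi (a * m) 0 \<in> H" if "semi a 0 \<in> H" for a m
    using that comp0[OF that] subgroup_SymD(2)[OF H] by (induction m) (auto simp: semi_0_0)
  have N_mult: "semi (N * m) 0 = id" for m
    using semi_cong_left[of "N * m" 0 0] by (simp add: semi_0_0 N_def cong_0_iff)
  define d where "d = (LEAST d. d > 0 \<and> semi d 0 \<in> H)"
  have "N > 0 \<and> semi N 0 \<in> H" using N N_mult[of 1] subgroup_SymD(2)[OF H] by simp
  then have d: "d > 0" "semi d 0 \<in> H"
    unfolding d_def using LeastI[of "\<lambda>d. d > 0 \<and> semi d 0 \<in> H" N] by simp_all
  have d_le: "d \<le> a" if "a > 0" "semi a 0 \<in> H" for a
    unfolding d_def by (rule Least_le) (use that in blast)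
  have d_dvd: "d dvd a" if a: "semi a 0 \<in> H" for a
  proof -
    \<comment> \<open>Since multiples of \<open>N\<close> act trivially, this removes
      \<open>a div d\<close> copies of \<open>d\<close> and leaves \<open>a mod d\<close>.\<close>
    have "semi (a + d * ((N - 1) * (a div d))) 0 \<in> H" using comp0[OF a mult0[OF d(2)]] .
    moreover have "a + d * ((N - 1) * (a div d)) = a mod d + N * (d * (a div d))"
    proof -
      have "d * (a div d) + d * ((N - 1) * (a div d)) = (1 + (N - 1)) * (d * (a div d))"
        by (simp add: algebra_simps)
      also have "1 + (N - 1) = N" using N by simp
      finally show ?thesis using mod_mult_div_eq[of a d] by linarith
    qed
    moreover have "semi (a mod d + N * (d * (a div d))) 0 = semi (a mod d) 0"
      by (rule semi_cong_left) (simp add: N_def cong_def)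
    ultimately have "semi (a mod d) 0 \<in> H" by simp
    then have "a mod d = 0" using d_le[of "a mod d"] d(1) by (metis gr0I leD mod_less_divisor)
    then show ?thesis by auto
  qed
  define s where "s = (LEAST s. s > 0 \<and> (\<exists>a. semi a s \<in> H))"
  have "semi 0 R = id" using semi_reduce_right[of 0 0 1] by (simp add: semi_0_0)
  then have R_mem: "semi 0 R \<in> H" using subgroup_SymD(2)[OF H] by simp
  then have "R > 0 \<and> (\<exists>a. semi a R \<in> H)" using R_pos by (intro conjI exI[of _ 0]) auto
  then have s: "s > 0" "\<exists>a. semi a s \<in> H"
    unfolding s_def using LeastI[of "\<lambda>s. s > 0 \<and> (\<exists>a. semi a s \<in> H)" R] by simp_all
  have s_le: "s \<le> b" if "b > 0" "semi a b \<in> H" for a b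
    unfolding s_def by (rule Least_le) (use that in blast)
  have "s \<le> R" using s_le[OF _ R_mem] R_pos by simp
  obtain i where i: "semi i s \<in> H" using s(2) by blast
  \<comment> \<open>The factor \<open>p ^ (R - s)\<close> undoes the twist by \<open>p ^ s\<close>,
    because \<open>p ^ R\<close> is 1 modulo \<open>N\<close>. Reducing modulo \<open>d\<close>
    changes the map only by multiplications already in \<open>H\<close>.\<close>
  define e where "e = (i * p ^ (R - s)) mod d"
  define m where "m = (i * p ^ (R - s)) div d"
  have "p ^ (R - s) * p ^ s = p ^ R" using \<open>s \<le> R\<close> by (simp flip: power_add)
  moreover have "e + d * m = i * p ^ (R - s)" by (simp add: e_def m_def)
  ultimately have em: "(e + d * m) * p ^ s = i * p ^ R" by (metis mult.assoc)
  \<comment> \<open>Modulo \<open>N\<close> this says that \<open>e * p ^ s\<close> is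
    \<open>i\<close> minus \<open>d * m * p ^ s\<close>.\<close>
  have "e * p ^ s + N * (d * m * p ^ s) = d * ((N - 1) * m * p ^ s) + i * p ^ R"
  proof -
    have "d * ((N - 1) * m * p ^ s) + (e + d * m) * p ^ s = e * p ^ s + ((N - 1) + 1) * (d * m * p ^ s)"
      by (simp add: algebra_simps)
    then show ?thesis using N em by simp
  qed
  moreover have "i * p ^ R = i + N * i" using field_size_gt_1 by (simp add: N_def algebra_simps)
  ultimately have eq: "e * p ^ s + N * (d * m * p ^ s) = (d * ((N - 1) * m * p ^ s) + i) + N * i"
    by linarith
  have "(e * p ^ s) mod N = (e * p ^ s + N * (d * m * p ^ s)) mod N" by simp
  also have "\<dots> = (d * ((N - 1) * m * p ^ s) + i) mod N" unfolding eq by simp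
  finally have "[e * p ^ s = d * ((N - 1) * m * p ^ s) + i] (mod N)" unfolding cong_def .
  then have "semi (e * p ^ s) s = semi (d * ((N - 1) * m * p ^ s) + i) s"
    unfolding N_def by (rule semi_cong_left)
  then have gen: "semi (e * p ^ s) s \<in> H" using comp0[OF mult0[OF d(2)] i] by simp
  have pow: "semi (twist e s j) (s * j) \<in> H" for j
  proof -
    have "semi (e * p ^ s) s ^^ j \<in> H"
      using gen subgroup_SymD(2,3)[OF H] by (induction j) auto
    then show ?thesis by (simp add: semi_generator_power)
  qed
  \<comment> \<open>This power of the second generator cancels \<open>s * n\<close> from the
    Frobenius exponent: the total is \<open>r\<close> plus a multiple of \<open>R\<close>.\<close>
  have red: "\<exists>a'. semi (twist e s ((R - 1) * n)) (s * ((R - 1) * n)) \<circ> semi a (r + s * n) = semi a' r" for a r n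
  proof -
    have "s * ((R - 1) * n) + (r + s * n) = r + ((R - 1) + 1) * (s * n)" by (simp add: algebra_simps)
    then have "s * ((R - 1) * n) + (r + s * n) = r + R * (s * n)" using R_pos by simp
    then show ?thesis unfolding semi_comp using semi_reduce_right by metis
  qed
  have s_dvd: "s dvd b" if ab: "semi a b \<in> H" for a b
  proof -
    let ?n = "b div s"
    obtain a' where "semi (twist e s ((R - 1) * ?n)) (s * ((R - 1) * ?n)) \<circ> semi a b = semi a' (b mod s)"
      using red[of ?n a "b mod s"] by auto
    then have "semi a' (b mod s) \<in> H" using subgroup_SymD(3)[OF H pow ab] by metis
    then have "b mod s = 0" using s_le[of "b mod s" a'] s(1) by (metis gr0I leD mod_less_divisor)
    then show ?thesis by auto
  qed
  let ?K = "GammaL1_subgroup p \<omega> d e s"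
  have K: "subgroup ?K Sym" using additive_groupD(1)[OF additive_group_GammaL1_subgroup] .
  have memK: "semi (d * i + twist e s j) (s * j) \<in> ?K" for i j unfolding GammaL1_subgroup_eq by blast
  have "?K \<subseteq> H"
    unfolding GammaL1_subgroup_eq using comp0[OF mult0[OF d(2)] pow] by blast
  moreover have "H \<subseteq> ?K"
  proof
    fix h assume h: "h \<in> H"
    then obtain a b where ab: "h = semi a b" using sub GammaL1_eq by blast
    then obtain n where n: "b = s * n" using s_dvd h by blast
    \<comment> \<open>\<open>?t\<close> lies in both groups and strips the Frobenius part from
      \<open>h\<close>. The remaining multiplication has exponent divisible by \<open>d\<close>,
      hence is in \<open>?K\<close>, where \<open>?t\<close> can be cancelled again.\<close>
    let ?t = "semi (twist e s ((R - 1) * n)) (s * ((R - 1) * n))"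
    obtain a' where a': "?t \<circ> h = semi a' 0" using red[of n a 0] ab n by auto
    then have "semi a' 0 \<in> H" using subgroup_SymD(3)[OF H pow h] by metis
    then obtain k where "a' = d * k" using d_dvd by blast
    then have "semi a' 0 \<in> ?K" using memK[of k 0] by simp
    moreover have t: "?t \<in> ?K" using memK[of 0] by simp
    ultimately have "inv_into UNIV ?t \<circ> (?t \<circ> h) \<in> ?K"
      using subgroup_SymD(3)[OF K subgroup_SymD(4)[OF K t]] a' by simp
    moreover have "inv_into UNIV ?t \<circ> (?t \<circ> h) = h"
      using bij_semi by (simp add: bij_is_inj flip: comp_assoc)
    ultimately show "h \<in> ?K" by simp
  qed
  moreover have "standard_form p R d e s"
  proof -
    have "d dvd p ^ R - 1" using d_dvd[of N] N_mult[of 1] subgroup_SymD(2)[OF H] by (simp add: N_def)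
    moreover have sR: "s dvd R" using s_dvd[OF R_mem] .
    moreover have "e < d" using d(1) by (simp add: e_def)
    moreover have "d dvd e * geometric (p ^ s) (R div s)"
    proof -
      \<comment> \<open>The Frobenius exponent is now \<open>R\<close>, so this power of the
        generator is a pure multiplication and \<open>d\<close> divides its exponent.\<close>
      have "semi (twist e s (R div s)) (0 + R * 1) \<in> H" using pow[of "R div s"] sR by simp
      then have "d dvd twist e s (R div s) * p ^ 0" using d_dvd unfolding semi_reduce_right by simp
      then show ?thesis using dvd_twist_iff[OF \<open>d dvd p ^ R - 1\<close>] by blast
    qed
    ultimately show ?thesis unfolding standard_form_iff using s(1) by blast
  qed
  ultimately show ?thesis by blast
qed

end

section \<open>Two-transitive subgroups of affine groups\<close>

locale two_transitive_affine =
  fixes L G :: "('a::{field,finite} \<Rightarrow> 'a) set"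
  assumes L: "additive_group L" and G: "subgroup G Sym" and G_sub: "G \<subseteq> affine_group L"
    and two_trans: "two_transitive G"
begin

lemma memE:
  assumes "g \<in> G"
  obtains h where "h \<in> L" "g = (\<lambda>x. h x + g 0)"
proof -
  have "g \<in> affine_group L" using assms G_sub by blast
  then obtain h t where h: "h \<in> L" "g = (\<lambda>x. h x + t)"
    using affine_groupE[OF additive_groupD(1)[OF L]] by metis
  then have "g 0 = t" using additive_groupD(6)[OF L h(1)] by simp
  then show thesis using that h by simp
qed

lemma stabiliser_sub: "g \<in> G \<Longrightarrow> g 0 = 0 \<Longrightarrow> g \<in> L"
  by (erule memE) simp

text \<open>An element of \<open>G\<close> fixing 0 and sending \<open>v\<close> to \<open>w\<close>
  is additive, so it conjugates one translation into the other. The lemma serves both for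
  \<open>M\<close> and for \<open>G\<close> inside itself.\<close>

lemma normal_contains_translations:
  assumes N: "N \<lhd> Sym\<lparr>carrier := G\<rparr>" and v: "(\<lambda>x. x + v) \<in> N" "v \<noteq> 0"
  shows "(\<lambda>x. x + w) \<in> N"
proof (cases "w = 0")
  case True
  have "subgroup N Sym" using N normal_Sym_iff[OF G] by blast
  then show ?thesis using True subgroup_SymD(2)[of N] by (simp add: id_def)
next
  case False
  obtain g where g: "g \<in> G" "g 0 = 0" "g v = w"
    using two_trans v(2) False unfolding two_transitive_def by metis
  have "g \<in> L" using stabiliser_sub g by blast
  have "\<forall>g\<in>G. \<forall>h\<in>N. \<exists>h'\<in>N. g \<circ> h = h' \<circ> g" using N normal_Sym_iff[OF G] by blast
  then obtain n where n: "n \<in> N" "g \<circ> (\<lambda>x. x + v) = n \<circ> g" using g(1) v(1) by blast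
  have "n y = y + w" for y
  proof -
    obtain x where x: "y = g x" using subgroup_SymD(1)[OF G g(1)] by (metis bij_pointE)
    have "n (g x) = g (x + v)" using fun_cong[OF n(2), of x] by simp
    then show ?thesis using additive_groupD(3)[OF L \<open>g \<in> L\<close>] g(3) x by simp
  qed
  then have "n = (\<lambda>y. y + w)" by (rule ext)
  then show ?thesis using n(1) by simp
qed

text \<open>Elements with the same linear part differ by a translation in \<open>G\<close>. Without
  nontrivial translations, taking linear parts therefore embeds \<open>G\<close> into
  \<open>L\<close>, which is too small for a two-transitive group.\<close>

lemma contains_translation:
  assumes "card L < CARD('a) * (CARD('a) - 1)"
  shows "\<exists>v. v \<noteq> 0 \<and> (\<lambda>x. x + v) \<in> G"
proof (rule ccontr)
  assume no: "\<not> ?thesis"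
  define \<phi> where "\<phi> g = (\<lambda>x. g x - g 0)" for g :: "'a \<Rightarrow> 'a"
  have "\<phi> ` G \<subseteq> L"
  proof clarify
    fix g assume "g \<in> G"
    then obtain h where h: "h \<in> L" "g = (\<lambda>x. h x + g 0)" by (rule memE)
    have "g x - g 0 = h x" for x using fun_cong[OF h(2), of x] by simp
    then have "\<phi> g = h" by (simp add: \<phi>_def)
    then show "\<phi> g \<in> L" using h(1) by simp
  qed
  moreover have "inj_on \<phi> G"
  proof (rule inj_onI)
    fix g g' assume g: "g \<in> G" "g' \<in> G" and eq: "\<phi> g = \<phi> g'"
    have shift: "g x = g' x + (g 0 - g' 0)" for x
      using fun_cong[OF eq, of x] by (simp add: \<phi>_def algebra_simps)
    have bij: "bij g'" using subgroup_SymD(1)[OF G g(2)] .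
    have "g \<circ> inv_into UNIV g' = (\<lambda>x. x + (g 0 - g' 0))"
    proof
      fix x show "(g \<circ> inv_into UNIV g') x = x + (g 0 - g' 0)"
        using shift[of "inv_into UNIV g' x"] bij by (simp add: bij_is_surj surj_f_inv_f)
    qed
    then have "(\<lambda>x. x + (g 0 - g' 0)) \<in> G"
      using subgroup_SymD(3)[OF G g(1) subgroup_SymD(4)[OF G g(2)]] by simp
    then have "g 0 - g' 0 = 0" using no by blast
    then have "g x = g' x" for x using shift[of x] by (simp only: add_0_right)
    then show "g = g'" by (rule ext)
  qed
  ultimately have "card G \<le> card L" by (metis card_image card_mono finite)
  moreover have "CARD('a) * (CARD('a) - 1) \<le> card G"
  proof -
    \<comment> \<open>Evaluation at 0 and 1 reaches every ordered pair of distinct points.\<close>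
    have "{(x, y). x \<noteq> y} \<subseteq> (\<lambda>g. (g 0, g 1)) ` G"
      using two_trans unfolding two_transitive_def image_def by clarsimp (metis zero_neq_one)
    then have "card {(x :: 'a, y). x \<noteq> y} \<le> card G"
      by (meson card_image_le card_mono finite le_trans)
    moreover have "{(x :: 'a, y). x \<noteq> y} = (SIGMA x:UNIV. UNIV - {x})" by auto
    ultimately show ?thesis by (simp add: card_Diff_singleton)
  qed
  ultimately show False using assms by simp
qed

lemma transitive_normal_contains_translation:
  assumes T: "\<And>v. (\<lambda>x. x + v) \<in> G" and M: "M \<lhd> Sym\<lparr>carrier := G\<rparr>"
    and trans: "transitive_on M UNIV"
  shows "\<exists>v. v \<noteq> 0 \<and> (\<lambda>x. x + v) \<in> M"
proof -
  have M': "subgroup M Sym" "M \<subseteq> G" and conj: "\<And>g h. g \<in> G \<Longrightarrow> h \<in> M \<Longrightarrow> \<exists>h'\<in>M. g \<circ> h = h' \<circ> g"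
    using M normal_Sym_iff[OF G] by auto
  \<comment> \<open>Sending 0 to 1 ensures that \<open>m\<close>, if its linear part is trivial, is
    itself a nontrivial translation.\<close>
  obtain m where m: "m \<in> M" "m 0 = 1" using trans unfolding transitive_on_def by blast
  obtain h where h: "h \<in> L" "m = (\<lambda>x. h x + m 0)" using m(1) M'(2) memE by blast
  show ?thesis
  proof (cases "\<forall>v. h v = v")
    case True
    then have "m = (\<lambda>x. x + 1)" using h(2) m(2) by simp
    then show ?thesis using m(1) by (intro exI[of _ 1]) simp
  next
    case False
    then obtain v where v: "h v \<noteq> v" by blast
    \<comment> \<open>\<open>m'\<close> is the conjugate of \<open>m\<close> under translation by
      \<open>v\<close>; composed with the inverse of \<open>m\<close> it is the translation by
      \<open>v - h v\<close>, nonzero by the choice of \<open>v\<close>.\<close>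
    obtain m' where m': "m' \<in> M" "(\<lambda>x. x + v) \<circ> m = m' \<circ> (\<lambda>x. x + v)"
      using conj[OF T m(1)] by blast
    have m'_eq: "m' y = m y + (v - h v)" for y
    proof -
      have "m' y = m (y - v) + v" using fun_cong[OF m'(2), of "y - v"] by simp
      also have "\<dots> = h (y - v) + m 0 + v" using fun_cong[OF h(2), of "y - v"] by simp
      also have "\<dots> = h y + m 0 + (v - h v)" by (simp add: additive_groupD(4)[OF L h(1)])
      also have "\<dots> = m y + (v - h v)" using fun_cong[OF h(2), of y] by simp
      finally show ?thesis .
    qed
    have "bij m" using subgroup_SymD(1)[OF M'(1) m(1)] .
    have "m' \<circ> inv_into UNIV m = (\<lambda>x. x + (v - h v))"
    proof
      fix x show "(m' \<circ> inv_into UNIV m) x = x + (v - h v)"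
        using m'_eq[of "inv_into UNIV m x"] \<open>bij m\<close> by (simp add: bij_is_surj surj_f_inv_f)
    qed
    then have "(\<lambda>x. x + (v - h v)) \<in> M"
      using subgroup_SymD(3)[OF M'(1) m'(1) subgroup_SymD(4)[OF M'(1) m(1)]] by simp
    then show ?thesis using v by (intro exI[of _ "v - h v"]) simp
  qed
qed

lemma stabiliser_decomposition:
  assumes H: "subgroup H Sym" "H \<subseteq> G" and T: "\<And>v. (\<lambda>x. x + v) \<in> H"
  shows "additive_group {g \<in> H. g 0 = 0}" "H = affine_group {g \<in> H. g 0 = 0}"
proof -
  let ?H0 = "{g \<in> H. g 0 = 0}"
  have sub: "subgroup ?H0 Sym"
    by (rule subgroup_SymI) (use subgroup_SymD[OF H(1)] in auto)
  moreover have "?H0 \<subseteq> L" using stabiliser_sub H(2) by blast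
  ultimately show "additive_group ?H0" using L by (auto simp: additive_group_def)
  show "H = affine_group ?H0"
  proof (intro equalityI subsetI)
    fix g assume g: "g \<in> H"
    \<comment> \<open>Translating by \<open>- g 0\<close> brings \<open>g\<close> into the
      stabiliser of 0 without leaving \<open>H\<close>.\<close>
    let ?h = "(\<lambda>x. x + (- g 0)) \<circ> g"
    have "?h \<in> ?H0" using subgroup_SymD(3)[OF H(1) T[of "- g 0"] g] by simp
    then have "(\<lambda>x. ?h x + g 0) \<in> affine_group ?H0" by (rule affine_groupI[OF sub])
    then show "g \<in> affine_group ?H0" by simp
  next
    fix g assume g: "g \<in> affine_group ?H0"
    obtain h t where "h \<in> ?H0" "g = (\<lambda>x. h x + t)" using sub g by (rule affine_groupE)
    then show "g \<in> H" using subgroup_SymD(3)[OF H(1) T[of t], of h] by (simp add: comp_def)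
  qed
qed

end

text \<open>The translations in \<open>M\<close> preserve each factor, so its edges at 0 determine
  it; arc-transitivity makes the neighbours of 0 a single orbit of the stabiliser.\<close>

lemma arc_transitive_factors_eq_orbit_factors:
  assumes M: "subgroup M Sym" and T: "\<And>v. (\<lambda>x. x + v) \<in> M"
    and part: "partition_on complete_edges \<E>" and arc: "\<And>E. E \<in> \<E> \<Longrightarrow> arc_transitive M E"
  shows "\<E> = orbit_factors {g \<in> M. g 0 = (0 :: 'a::field)}"
proof -
  let ?M0 = "{g \<in> M. g 0 = 0}"
  have image: "g ` e \<in> E" if "E \<in> \<E>" "g \<in> M" "e \<in> E" for g e E
    using arc[OF that(1)] that(2,3) unfolding arc_transitive_def edge_image_def by blast
  have shift: "{u, v} \<in> E \<longleftrightarrow> {0, v - u} \<in> E" if E: "E \<in> \<E>" for E u v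
  proof
    show "{0, v - u} \<in> E" if "{u, v} \<in> E" using image[OF E T[of "- u"] that] by simp
    show "{u, v} \<in> E" if "{0, v - u} \<in> E" using image[OF E T[of u] that] by simp
  qed
  have edge: "e \<in> complete_edges" if "E \<in> \<E>" "e \<in> E" for E e
    using partition_onD1[OF part] that by blast
  have factor: "E = cayley_edges (orbit_of ?M0 v)" if E: "E \<in> \<E>" and v: "v \<noteq> 0" "{0, v} \<in> E" for E v
  proof -
    have orbit: "x \<in> orbit_of ?M0 v \<longleftrightarrow> {0, x} \<in> E" for x
    proof
      assume "x \<in> orbit_of ?M0 v"
      then obtain g where "g \<in> M" "g 0 = 0" "x = g v" by auto
      then show "{0, x} \<in> E" using image[OF E _ v(2), of g] by simp
    next
      assume x: "{0, x} \<in> E"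
      then have "x \<noteq> 0" using edge[OF E x] by (auto simp: complete_edges_def)
      then obtain g where "g \<in> M" "g 0 = 0" "g v = x"
        using arc[OF E] v x unfolding arc_transitive_def by metis
      then show "x \<in> orbit_of ?M0 v" by blast
    qed
    show ?thesis
    proof (intro equalityI subsetI)
      fix e assume e: "e \<in> E"
      then obtain a b where ab: "e = {a, b}" using edge[OF E e] by (auto simp: complete_edges_def card_2_iff)
      then have "b - a \<in> orbit_of ?M0 v" unfolding orbit using shift[OF E] e by simp
      then show "e \<in> cayley_edges (orbit_of ?M0 v)" using ab unfolding cayley_edges_def by blast
    next
      fix e assume "e \<in> cayley_edges (orbit_of ?M0 v)"
      then obtain a b where ab: "e = {a, b}" "b - a \<in> orbit_of ?M0 v" unfolding cayley_edges_def by blast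
      then show "e \<in> E" unfolding orbit using shift[OF E, of a b] by simp
    qed
  qed
  show ?thesis
  proof (intro equalityI subsetI)
    fix E assume E: "E \<in> \<E>"
    then obtain e where e: "e \<in> E" using partition_onD3[OF part] by fastforce
    then obtain a b where ab: "e = {a, b}" "a \<noteq> b"
      using edge[OF E e] by (auto simp: complete_edges_def card_2_iff)
    then have "E = cayley_edges (orbit_of ?M0 (b - a))" using factor[OF E] shift[OF E] e by simp
    then show "E \<in> orbit_factors ?M0"
      unfolding orbit_factors_def using orbits_on_nonzeroI[of "b - a" ?M0] ab(2) by simp
  next
    fix E assume "E \<in> orbit_factors ?M0"
    then obtain S where S: "S \<in> orbits_on ?M0 nonzero" "E = cayley_edges S"
      by (auto simp: orbit_factors_def)
    then obtain v where v: "v \<noteq> 0" "S = orbit_of ?M0 v" by (elim orbits_on_nonzeroE)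
    have "{0, v} \<in> complete_edges" using v(1) by (simp add: complete_edges_def)
    \<comment> \<open>Every orbit occurs: the factor containing the edge from 0 to \<open>v\<close>
      must be its Cayley graph.\<close>
    then obtain F where "F \<in> \<E>" "{0, v} \<in> F" using partition_onD1[OF part] by blast
    then show "E \<in> \<E>" using factor[of F v] v S by simp
  qed
qed

section \<open>The construction and its converse\<close>

context finite_field_generator
begin

lemma admissible_construction:
  assumes "admissible p R \<omega> d e s d1 e1 s1"
  defines "G0 \<equiv> GammaL1_subgroup p \<omega> d e s" and "M0 \<equiv> GammaL1_subgroup p \<omega> d1 e1 s1"
  shows "orbit_factorisation G0 M0"
    and "real (card (orbits_on M0 nonzero)) = real d1 / real (merge_length p d1 e1 s1)"
proof -
  have adm: "standard_form p R d1 e1 s1" "M0 \<lhd> Sym\<lparr>carrier := G0\<rparr>" "transitive_on G0 nonzero"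
    "\<not> transitive_on M0 nonzero" "odd p \<longrightarrow> even (card M0)"
    using assms(1) by (simp_all add: admissible_def Let_def G0_def M0_def)
  have add: "additive_group G0" "additive_group M0"
    by (simp_all add: G0_def M0_def additive_group_GammaL1_subgroup)
  \<comment> \<open>For even \<open>p\<close> the factor \<open>p ^ R\<close> is even because
    \<open>R\<close> is positive; for odd \<open>p\<close> the factor \<open>card M0\<close>
    is.\<close>
  have even: "even (card (affine_group M0))"
    using adm(5) R_pos by (auto simp: card_affine_group[OF add(2)] card_field)
  interpret orbit_factorisation G0 M0
    by (rule orbit_factorisation.intro[OF add adm(2-4) even])
  show "orbit_factorisation G0 M0" by (rule orbit_factorisation_axioms)
  let ?k = "card (orbits_on M0 nonzero)" and ?c = "merge_length p d1 e1 s1" and ?S = "orbit_of M0 1"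
  have *: "?k * card ?S = p ^ R - 1"
    using card_orbits_times_card_orbit[OF orbits_on_nonzeroI[of 1]] card_field by simp
  have **: "card ?S * d1 = (p ^ R - 1) * ?c"
    using card_orbit_of_1[OF adm(1)] by (simp add: M0_def)
  \<comment> \<open>Eliminating \<open>card ?S\<close> from the two counts gives
    \<open>d1 = ?k * ?c\<close>, so the real quotient is exact.\<close>
  have "(p ^ R - 1) * d1 = ?k * (card ?S * d1)" unfolding *[symmetric] by (rule mult.assoc)
  also have "\<dots> = (p ^ R - 1) * (?k * ?c)" unfolding ** by (rule mult.left_commute)
  finally have "(p ^ R - 1) * d1 = (p ^ R - 1) * (?k * ?c)" .
  then have "d1 = ?k * ?c" using field_size_gt_1 by simp
  then have "real ?k * real ?c = real d1" unfolding of_nat_mult[symmetric] by (rule arg_cong[OF sym])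
  moreover have "real ?c \<noteq> 0" using merge_length(1)[OF adm(1)] by simp
  ultimately show "real ?k = real d1 / real ?c" by (intro eq_divide_imp)
qed

lemma factorisation_arises_from_admissible:
  assumes fact: "weak_homogeneous_factorisation M G \<E> k" and arc: "\<And>E. E \<in> \<E> \<Longrightarrow> arc_transitive M E"
    and sub: "G \<subseteq> AGammaL1 p \<omega>" and two: "two_transitive G" and even: "even (card M)"
  shows "\<exists>d e s d1 e1 s1. admissible p R \<omega> d e s d1 e1 s1 \<and>
    G = affine_group (GammaL1_subgroup p \<omega> d e s) \<and>
    M = affine_group (GammaL1_subgroup p \<omega> d1 e1 s1) \<and>
    \<E> = orbit_factors (GammaL1_subgroup p \<omega> d1 e1 s1)"
proof -
  have part: "partition_on complete_edges \<E>" and k: "k > 1" "card \<E> = k" and G: "subgroup G Sym"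
    and normal: "M \<lhd> Sym\<lparr>carrier := G\<rparr>" and trans: "transitive_on M UNIV"
    using fact by (auto simp: weak_homogeneous_factorisation_def transitive_factorisation_def)
  interpret two_transitive_affine "GammaL1 p \<omega>" G
    by (rule two_transitive_affine.intro[OF additive_group_GammaL1 G sub[unfolded AGammaL1_def] two])
  have M: "subgroup M Sym" "M \<subseteq> G" and conj: "\<And>g h. g \<in> G \<Longrightarrow> h \<in> M \<Longrightarrow> \<exists>h'\<in>M. g \<circ> h = h' \<circ> g"
    using normal normal_Sym_iff[OF G] by auto
  \<comment> \<open>This places the bound on the order of \<Gamma>L strictly below the number of
    ordered pairs of distinct points.\<close>
  have "R < p ^ R" using prime_gt_1_nat[OF prime_p] by (intro power_gt_expt) simp
  then have "(p ^ R - 1) * R < p ^ R * (p ^ R - 1)" using field_size_gt_1 by simp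
  with card_GammaL1_le have "card (GammaL1 p \<omega>) < CARD('a) * (CARD('a) - 1)"
    unfolding card_field by (rule le_less_trans)
  then obtain a where a: "a \<noteq> 0" "(\<lambda>x. x + a) \<in> G" using contains_translation by blast
  \<comment> \<open>Viewing \<open>G\<close> as normal in itself lets conjugation spread one
    translation to all of them.\<close>
  have "G \<lhd> Sym\<lparr>carrier := G\<rparr>"
    unfolding normal_Sym_iff[OF G]
  proof (intro conjI ballI subset_refl G)
    fix g h assume gh: "g \<in> G" "h \<in> G"
    let ?h = "g \<circ> h \<circ> inv_into UNIV g"
    have "?h \<in> G" using gh subgroup_SymD(3,4)[OF G] by blast
    moreover have "g \<circ> h = ?h \<circ> g"
      using subgroup_SymD(1)[OF G gh(1)] by (simp add: bij_is_inj comp_assoc)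
    ultimately show "\<exists>h'\<in>G. g \<circ> h = h' \<circ> g" by blast
  qed
  then have TG: "(\<lambda>x. x + v) \<in> G" for v using a(2,1) by (rule normal_contains_translations)
  obtain b where b: "b \<noteq> 0" "(\<lambda>x. x + b) \<in> M"
    using transitive_normal_contains_translation[OF TG normal trans] by blast
  have TM: "(\<lambda>x. x + v) \<in> M" for v using normal b(2,1) by (rule normal_contains_translations)
  define G0 M0 where "G0 = {g \<in> G. g 0 = 0}" and "M0 = {g \<in> M. g 0 = 0}"
  have G0: "additive_group G0" "G = affine_group G0"
    using stabiliser_decomposition[OF G subset_refl TG] by (simp_all add: G0_def)
  have M0: "additive_group M0" "M = affine_group M0"
    using stabiliser_decomposition[OF M TM] by (simp_all add: M0_def)
  have sub0: "M0 \<subseteq> GammaL1 p \<omega>" "G0 \<subseteq> GammaL1 p \<omega>"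
    using stabiliser_sub M(2) by (auto simp: M0_def G0_def)
  obtain d e s where std: "standard_form p R d e s" "G0 = GammaL1_subgroup p \<omega> d e s"
    using subgroup_standard_form[OF additive_groupD(1)[OF G0(1)] sub0(2)] by blast
  obtain d1 e1 s1 where std1: "standard_form p R d1 e1 s1" "M0 = GammaL1_subgroup p \<omega> d1 e1 s1"
    using subgroup_standard_form[OF additive_groupD(1)[OF M0(1)] sub0(1)] by blast
  have \<E>: "\<E> = orbit_factors M0"
    unfolding M0_def by (rule arc_transitive_factors_eq_orbit_factors[OF M(1) TM part arc])
  have "M0 \<lhd> Sym\<lparr>carrier := G0\<rparr>"
    unfolding normal_Sym_iff[OF additive_groupD(1)[OF G0(1)]]
  proof (intro conjI ballI)
    show "subgroup M0 Sym" by (rule additive_groupD(1)[OF M0(1)])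
    show "M0 \<subseteq> G0" using M(2) by (auto simp: M0_def G0_def)
    fix g h assume gh: "g \<in> G0" "h \<in> M0"
    then obtain h' where h': "h' \<in> M" "g \<circ> h = h' \<circ> g" using conj by (auto simp: M0_def G0_def)
    \<comment> \<open>Both \<open>g\<close> and \<open>h\<close> fix 0, hence so does
      \<open>h'\<close>.\<close>
    have "h' 0 = 0" using fun_cong[OF h'(2), of 0] gh by (simp add: M0_def G0_def)
    then show "\<exists>h'\<in>M0. g \<circ> h = h' \<circ> g" using h' by (auto simp: M0_def)
  qed
  moreover have "transitive_on G0 nonzero"
    unfolding transitive_on_def
  proof (intro ballI)
    fix x y :: 'a assume "x \<in> nonzero" "y \<in> nonzero"
    then have "\<exists>g\<in>G. g 0 = 0 \<and> g x = y"
      using two[unfolded two_transitive_def, rule_format, of 0 x 0 y] by simp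
    then show "\<exists>h\<in>G0. h x = y" by (auto simp: G0_def)
  qed
  moreover have "\<not> transitive_on M0 nonzero"
  proof
    \<comment> \<open>A transitive \<open>M0\<close> would have one orbit and leave one factor,
      against \<open>k > 1\<close>.\<close>
    assume tr: "transitive_on M0 nonzero"
    have "orbit_of M0 x = nonzero" if "x \<noteq> 0" for x
    proof (intro equalityI subsetI)
      show "y \<in> nonzero" if "y \<in> orbit_of M0 x" for y
        using that \<open>x \<noteq> 0\<close> additive_groupD(7)[OF M0(1)] by auto
      show "y \<in> orbit_of M0 x" if "y \<in> nonzero" for y
      proof -
        have "\<exists>h\<in>M0. h x = y" using tr that \<open>x \<noteq> 0\<close> unfolding transitive_on_def by simp
        then show ?thesis by (elim bexE) (rule image_eqI, simp_all)
      qed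
    qed
    then have "orbits_on M0 nonzero \<subseteq> {nonzero}" by (auto elim!: orbits_on_nonzeroE)
    then have "\<E> \<subseteq> {cayley_edges nonzero}" unfolding \<E> orbit_factors_def by blast
    then have "card \<E> \<le> card {cayley_edges (nonzero :: 'a set)}" by (intro card_mono) auto
    then show False using k by simp
  qed
  \<comment> \<open>For odd \<open>p\<close> the number of translations is odd, so evenness of
    \<open>card M\<close> falls on \<open>M0\<close>.\<close>
  moreover have "odd p \<longrightarrow> even (card M0)"
    using even card_affine_group[OF M0(1)] M0(2) card_field by auto
  ultimately have "admissible p R \<omega> d e s d1 e1 s1"
    using std std1 by (simp add: admissible_def)
  then show ?thesis using G0(2) M0(2) \<E> std(2) std1(2) by blast
qed

end

text \<open>The group \<open>affine_group M0\<close> gives a weak factorisation and the full kernel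
  a homogeneous one. The converse starts from the weak notion and thus covers homogeneous
  factorisations too, by \<open>homogeneous_imp_weak\<close>.\<close>

theorem theorem7p11:
  fixes p R :: nat and \<omega> :: "'a::{field, finite}"
  assumes "prime p" and "R \<ge> 1" and "CARD('a) = p ^ R" and "primitive_element \<omega>"
  shows
    "(\<forall>d e s d1 e1 s1 G0 M0 G M \<E> k.
        admissible p R \<omega> d e s d1 e1 s1 \<longrightarrow>
        G0 = GammaL1_subgroup p \<omega> d e s \<longrightarrow>
        M0 = GammaL1_subgroup p \<omega> d1 e1 s1 \<longrightarrow>
        G = affine_group G0 \<longrightarrow> M = affine_group M0 \<longrightarrow>
        \<E> = orbit_factors M0 \<longrightarrow> k = card (orbits_on M0 nonzero) \<longrightarrow>
          weak_homogeneous_factorisation M G \<E> k \<and>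
          homogeneous_factorisation (factor_kernel G \<E>) G \<E> k \<and>
          real k = real d1 / real (merge_length p d1 e1 s1) \<and>
          (\<forall>S\<in>orbits_on M0 nonzero.
             sym (cayley_arcs S) \<and> arc_transitive M (cayley_edges S)))
     \<and>
     (\<forall>M G \<E> k.
        weak_homogeneous_factorisation M G \<E> k \<longrightarrow>
        (\<forall>E\<in>\<E>. arc_transitive M E) \<longrightarrow>
        G \<subseteq> AGammaL1 p \<omega> \<longrightarrow> two_transitive G \<longrightarrow> even (card M) \<longrightarrow>
          (\<exists>d e s d1 e1 s1.
             admissible p R \<omega> d e s d1 e1 s1 \<and>
             G = affine_group (GammaL1_subgroup p \<omega> d e s) \<and>
             M = affine_group (GammaL1_subgroup p \<omega> d1 e1 s1) \<and>
             \<E> = orbit_factors (GammaL1_subgroup p \<omega> d1 e1 s1)))"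
proof -
  interpret finite_field_generator p R \<omega> using assms by unfold_locales
  show ?thesis
  proof (rule conjI; intro allI impI)
    fix d e s d1 e1 s1 G0 M0 G M \<E> k
    assume adm: "admissible p R \<omega> d e s d1 e1 s1"
      and defs: "G0 = GammaL1_subgroup p \<omega> d e s" "M0 = GammaL1_subgroup p \<omega> d1 e1 s1"
        "G = affine_group G0" "M = affine_group M0" "\<E> = orbit_factors M0"
        "k = card (orbits_on M0 nonzero)"
    interpret orbit_factorisation G0 M0
      using admissible_construction(1)[OF adm] defs(1,2) by simp
    show "weak_homogeneous_factorisation M G \<E> k \<and>
        homogeneous_factorisation (factor_kernel G \<E>) G \<E> k \<and>
        real k = real d1 / real (merge_length p d1 e1 s1) \<and>
        (\<forall>S\<in>orbits_on M0 nonzero. sym (cayley_arcs S) \<and> arc_transitive M (cayley_edges S))"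
    proof (intro conjI ballI)
      show "weak_homogeneous_factorisation M G \<E> k"
        unfolding defs(3-6) by (rule weak_homogeneous_factorisation_orbits)
      show "homogeneous_factorisation (factor_kernel G \<E>) G \<E> k"
        unfolding defs(3-6) by (rule homogeneous_factorisation_orbits)
      show "real k = real d1 / real (merge_length p d1 e1 s1)"
        using admissible_construction(2)[OF adm] defs(2,6) by simp
      show "sym (cayley_arcs S)" if "S \<in> orbits_on M0 nonzero" for S
        using that by (rule sym_cayley_arcs)
      show "arc_transitive M (cayley_edges S)" if "S \<in> orbits_on M0 nonzero" for S
        unfolding defs(4) using that by (rule arc_transitive_cayley_edges)
    qed
  next
    fix M G \<E> k
    assume "weak_homogeneous_factorisation M G \<E> k" "\<forall>E\<in>\<E>. arc_transitive M E"
      "G \<subseteq> AGammaL1 p \<omega>" "two_transitive G" "even (card M)"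
    then show "\<exists>d e s d1 e1 s1. admissible p R \<omega> d e s d1 e1 s1 \<and>
        G = affine_group (GammaL1_subgroup p \<omega> d e s) \<and>
        M = affine_group (GammaL1_subgroup p \<omega> d1 e1 s1) \<and>
        \<E> = orbit_factors (GammaL1_subgroup p \<omega> d1 e1 s1)"
      by (intro factorisation_arises_from_admissible) auto
  qed
qed

end
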